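(* Let $\phi_0,\dots,\phi_n$ be orthogonal polynomials on $[-1,1]$ (with respect to a positive measure) with $\deg \phi_j=j$, such that the associated matrix $H$ is real and symmetric. Let $C=H-e_1c^T$, $p(x)=\nu_n\det(xI-C)$, let $C+\delta C=H+\delta H-(e_1+\delta e_1)(c+\delta c)^T$ with $\|\delta H\|_2\le\epsilon_H<1$, $\|\delta c\|_2\le\epsilon_c$, $\|\delta e_1\|_2\le\epsilon_1$, and let $p(x)+\delta p(x)=\nu_n\det(xI-C-\delta C)$. Let $\{\rho_j\}_{j=0}^n$ be distinct points in $[-1,1]$, none of which is a root of $\phi_n$, and let $r_1,\dots,r_n$ be the roots of $\phi_n$. Let $\{\ell_j(x)\}_{j=0}^n$ be the Lagrange polynomials defined on the nodes $\rho_0,\dots,\rho_n$, and let $L$ be the $(n+1)\times(n+1)$ matrix whose columns contain the coefficients of the polynomials $\ell_0,\dots,\ell_n$ with respect to the basis $\{\phi_i\}_{i=0}^n$ (rows ordered by $\phi_0,\dots,\phi_n$). Then the vector of coefficients of $\delta p$ in the basis $\{\phi_j\}$ satisfies $$\|\delta p\|_\infty\le\|\hat L\|_\infty\cdot\left(\max_{j=0,\dots,n}\Gamma_1(\rho_j)\epsilon_1+\Gamma_c(\rho_j)\epsilon_c+\Gamma_H(\rho_j)\epsilon_H\right)+O(\epsilon_H^2+\epsilon_1^2+\epsilon_c^2),$$ where $\hat L$ is the matrix consisting of the first $n$ rows of $L$ (those corresponding to $\phi_0,\dots,\phi_{n-1}$), and the maximum is of the whole sum over $j$.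
   Context: Let $n\ge1$; $\nu_j>0$ is the leading coefficient of $\phi_j$ (in the monomial basis), $\chi=\nu_n\nu_{n-1}^{-1}$, and $\Phi(x)=[\phi_{n-1}(x),\dots,\phi_1(x),\phi_0(x)]^T$. $H$ is the unique constant $n\times n$ matrix with $H\Phi(x)=x\Phi(x)-\chi^{-1}\phi_n(x)e_1$, so that $\phi_n(x)=\nu_n\det(xI-H)$. The vector $c$ has length $n$, $C=H-e_1c^T$ and $p(x)=\nu_n\det(xI-C)$ (equivalently $p=\phi_n+\chi c^T\Phi$, i.e. the factor $\chi^{-1}$ of the confederate matrix is absorbed in $c$). The perturbations $\delta H$, $\delta e_1$, $\delta c$ are real or complex. Writing $\delta p(x)=\sum_{j=0}^{n-1}\delta p_j\phi_j(x)$, $\|\delta p\|_\infty=\max_j|\delta p_j|$; for matrices $\|\cdot\|_\infty$ is the maximum absolute row sum. For $\xi\in\mathbb{C}$ not a root of $\phi_n$: $$S(\xi)=\sum_{j=1}^n\frac1{|\xi-r_j|},\quad M(\xi)=\max_{j}\frac1{|\xi-r_j|},\quad \Gamma_1(\xi)=M(\xi)|\phi_n(\xi)|\,\|c\|_2,\quad\Gamma_c(\xi)=\chi\|\Phi(\xi)\|_2,$$ $$\Gamma_H(\xi)=S(\xi)|\phi_n(\xi)|+\Gamma_c(\xi)[M(\xi)+S(\xi)]\|c\|_2.$$ The Lagrange polynomials satisfy $\deg\ell_j\le n$ and $\ell_j(\rho_i)=\delta_{ij}$. The $O(\cdot)$ term is for fixed basis, $c$ and nodes, as $\epsilon_H,\epsilon_1,\epsilon_c\to0$,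 uniformly over all perturbations satisfying the norm bounds. *)

theory Defs
  imports
    "HOL-Analysis.Bochner_Integration"
    "HOL-Analysis.L2_Norm"
    "HOL-Library.Landau_Symbols"
    "Jordan_Normal_Form.Char_Poly"
begin

hide_const (open) Finite_Cartesian_Product.vec
hide_type (open) Finite_Cartesian_Product.vec
unbundle no vec_syntax

text \<open>Matrices and vectors have type \<^typ>\<open>'a Matrix.mat\<close> and \<^typ>\<open>'a Matrix.vec\<close>, indexed from 0; the
  vector $e_1$ is \<^term>\<open>unit_vec n 0\<close>.  Real data are embedded into the complex numbers, because
  $c$ and the perturbations may be complex.\<close>

abbreviation cpoly :: "real poly \<Rightarrow> complex poly" where
  "cpoly \<equiv> map_poly complex_of_real"

abbreviation cmat :: "real mat \<Rightarrow> complex mat" where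
  "cmat \<equiv> map_mat complex_of_real"


subsection \<open>Norms\<close>

definition vec_norm2 :: "complex Matrix.vec \<Rightarrow> real" where
  "vec_norm2 v = L2_set (\<lambda>i. cmod (v $ i)) {..<dim_vec v}"

definition mat_norm2 :: "complex mat \<Rightarrow> real" where
  "mat_norm2 A =
    (SUP v \<in> {v \<in> carrier_vec (dim_col A). vec_norm2 v = 1}. vec_norm2 (A *\<^sub>v v))"

definition mat_norm_inf :: "real mat \<Rightarrow> real" where
  "mat_norm_inf A = (MAX i \<in> {..<dim_row A}. \<Sum>j<dim_col A. \<bar>A $$ (i, j)\<bar>)"

text \<open>The product $u v^T$, without conjugation.\<close>

definition outer_prod :: "complex Matrix.vec \<Rightarrow> complex Matrix.vec \<Rightarrow> complex mat" where
  "outer_prod u v = mat (dim_vec u) (dim_vec v) (\<lambda>(i, j). u $ i * v $ j)"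


subsection \<open>Orthogonal polynomials and the associated matrix\<close>

text \<open>Finiteness of \<^term>\<open>\<mu>\<close> makes all polynomials square integrable, since \<^term>\<open>\<mu>\<close> is concentrated
  on $[-1,1]$.  No normalisation is imposed.\<close>

definition orthogonal_polys :: "real measure \<Rightarrow> nat \<Rightarrow> (nat \<Rightarrow> real poly) \<Rightarrow> bool" where
  "orthogonal_polys \<mu> n \<phi> \<longleftrightarrow>
     sets \<mu> = sets borel \<and> finite_measure \<mu> \<and> (AE x in \<mu>. x \<in> {-1..1}) \<and>
     (\<forall>j\<le>n. degree (\<phi> j) = j) \<and>
     (\<forall>j\<le>n. 0 < (\<integral>x. (poly (\<phi> j) x)\<^sup>2 \<partial>\<mu>)) \<and>
     (\<forall>i\<le>n. \<forall>j\<le>n. i \<noteq> j \<longrightarrow> (\<integral>x. poly (\<phi> i) x * poly (\<phi> j) x \<partial>\<mu>) = 0)"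

definition basis_vec :: "nat \<Rightarrow> (nat \<Rightarrow> real poly) \<Rightarrow> complex \<Rightarrow> complex Matrix.vec" where
  "basis_vec n \<phi> x = Matrix.vec n (\<lambda>i. poly (cpoly (\<phi> (n - 1 - i))) x)"

definition lead_ratio :: "nat \<Rightarrow> (nat \<Rightarrow> real poly) \<Rightarrow> real" where
  "lead_ratio n \<phi> = lead_coeff (\<phi> n) / lead_coeff (\<phi> (n - 1))"

text \<open>For \<^term>\<open>n \<ge> (1::nat)\<close> and \<^term>\<open>\<phi>\<close> of the stated degrees these conditions determine
  \<^term>\<open>H\<close> uniquely.\<close>

definition associated_matrix :: "nat \<Rightarrow> (nat \<Rightarrow> real poly) \<Rightarrow> real mat \<Rightarrow> bool" where
  "associated_matrix n \<phi> H \<longleftrightarrow>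
     H \<in> carrier_mat n n \<and>
     (\<forall>x. cmat H *\<^sub>v basis_vec n \<phi> x =
        x \<cdot>\<^sub>v basis_vec n \<phi> x
          - (poly (cpoly (\<phi> n)) x / complex_of_real (lead_ratio n \<phi>)) \<cdot>\<^sub>v unit_vec n 0)"


subsection \<open>Lagrange polynomials\<close>

definition lagrange_polys :: "nat \<Rightarrow> (nat \<Rightarrow> real) \<Rightarrow> (nat \<Rightarrow> real poly) \<Rightarrow> bool" where
  "lagrange_polys n \<rho> l \<longleftrightarrow>
     (\<forall>j\<le>n. degree (l j) \<le> n \<and> (\<forall>i\<le>n. poly (l j) (\<rho> i) = (if i = j then 1 else 0)))"

definition coeff_matrix ::
    "nat \<Rightarrow> (nat \<Rightarrow> real poly) \<Rightarrow> (nat \<Rightarrow> real poly) \<Rightarrow> real mat \<Rightarrow> bool" where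
  "coeff_matrix n \<phi> l L \<longleftrightarrow>
     L \<in> carrier_mat (n + 1) (n + 1) \<and>
     (\<forall>j\<le>n. l j = (\<Sum>i\<le>n. Polynomial.smult (L $$ (i, j)) (\<phi> i)))"

definition first_rows :: "nat \<Rightarrow> 'a mat \<Rightarrow> 'a mat" where
  "first_rows k A = mat k (dim_col A) (\<lambda>(i, j). A $$ (i, j))"


subsection \<open>The condition functions\<close>

text \<open>Here $r_1,\dots,r_n$ are the roots of \<^term>\<open>\<phi> n\<close>.\<close>

definition root_sum :: "nat \<Rightarrow> (nat \<Rightarrow> complex) \<Rightarrow> complex \<Rightarrow> real" where
  "root_sum n r \<xi> = (\<Sum>j=1..n. 1 / cmod (\<xi> - r j))"

definition root_max :: "nat \<Rightarrow> (nat \<Rightarrow> complex) \<Rightarrow> complex \<Rightarrow> real" where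
  "root_max n r \<xi> = (MAX j\<in>{1..n}. 1 / cmod (\<xi> - r j))"

definition Gamma_1 :: "nat \<Rightarrow> (nat \<Rightarrow> real poly) \<Rightarrow> (nat \<Rightarrow> complex) \<Rightarrow> complex Matrix.vec \<Rightarrow>
    complex \<Rightarrow> real" where
  "Gamma_1 n \<phi> r c \<xi> = root_max n r \<xi> * cmod (poly (cpoly (\<phi> n)) \<xi>) * vec_norm2 c"

definition Gamma_c :: "nat \<Rightarrow> (nat \<Rightarrow> real poly) \<Rightarrow> complex \<Rightarrow> real" where
  "Gamma_c n \<phi> \<xi> = lead_ratio n \<phi> * vec_norm2 (basis_vec n \<phi> \<xi>)"

definition Gamma_H :: "nat \<Rightarrow> (nat \<Rightarrow> real poly) \<Rightarrow> (nat \<Rightarrow> complex) \<Rightarrow> complex Matrix.vec \<Rightarrow>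
    complex \<Rightarrow> real" where
  "Gamma_H n \<phi> r c \<xi> =
     root_sum n r \<xi> * cmod (poly (cpoly (\<phi> n)) \<xi>)
     + Gamma_c n \<phi> \<xi> * (root_max n r \<xi> + root_sum n r \<xi>) * vec_norm2 c"

end

theory Submission
  imports Defs
begin

text \<open>
  The eigenvectors of $H$ are the vectors $\Phi(r_j)$.  Symmetry of $H$ yields a Christoffel--Darboux
  identity, which makes the $r_j$ real and simple and the $\Phi(r_j)$ pairwise orthogonal, so that $H$
  is diagonalised by an orthogonal matrix without appeal to a general spectral theorem.  Hence
  $W = (xI - H)^{-1}$ satisfies $\|Wv\|_2 \le M(x)\|v\|_2$ and $|\mathrm{tr}(WX)| \le S(x)\|X\|_2$, and
  $We_1 = \chi\,\Phi(x)/\phi_n(x)$.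

  The derivative of $\det$ at $xI - C = xI - H + e_1c^T$ in direction $B$ is
  $\det(xI - H)\,[(1 + c^TWe_1)\,\mathrm{tr}(WB) - c^TWBWe_1]$.  Inserting the perturbation for $B$ bounds
  $|\delta p(x)|$ to first order by $\Gamma_1\epsilon_1 + \Gamma_c\epsilon_c + \Gamma_H\epsilon_H$, and the
  Leibniz formula controls the second-order remainder.  Finally $\delta p$ has degree less than $n$, so
  its coefficient vector is $\hat L$ applied to the values $\delta p(\rho_j)$.
\<close>

subsection \<open>Second-order expansion of the determinant\<close>

text \<open>The nodes avoid the roots of phi_n but may hit roots of p, where xI - C is singular.
  Hence every estimate goes through the resolvent W of H alone, and the derivative of the
  determinant is needed in a form that makes sense at singular matrices. The condition functions are
  |phi_n(x)| times bounds on the linear terms, where phi_n W e_1 = chi Phi turns a factor |phi_n| |W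
  e_1| into Gamma_c. In the directions e_1 dc^T and de_1 c^T the factor 1 + c^T W e_1 cancels and
  leaves dc^T W e_1 and c^T W de_1, which give Gamma_c and Gamma_1. In the direction dH it survives
  in front of the trace and contributes S (|phi_n| + Gamma_c |c|); the other term contributes M
  Gamma_c |c|, and the sum is Gamma_H. A trace adds up over all eigenvalues, hence S; the norm of W
  sees only the nearest one, hence M. Scalar products are bilinear, without conjugation. Reality of
  the eigenvectors links them to Euclidean norms of complex vectors.\<close>

lemma norm_prod_add_diff_le:
  fixes a b :: "'i \<Rightarrow> complex" and \<alpha> \<beta> :: real
  assumes "finite I" and "\<And>i. i \<in> I \<Longrightarrow> norm (a i) \<le> \<alpha>" and "\<And>i. i \<in> I \<Longrightarrow> norm (b i) \<le> \<beta>"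
    and "1 \<le> \<alpha>" and "0 \<le> \<beta>"
  shows "norm ((\<Prod>i\<in>I. a i + b i) - (\<Prod>i\<in>I. a i)) \<le> card I * \<beta> * (\<alpha> + \<beta>) ^ card I"
  using assms(1-3)
proof (induction I rule: finite_induct)
  case (insert x I)
  let ?P = "\<Prod>i\<in>I. a i + b i" and ?p = "\<Prod>i\<in>I. a i" and ?k = "card I"
  have IH: "norm (?P - ?p) \<le> ?k * \<beta> * (\<alpha> + \<beta>) ^ ?k"
    using insert by simp
  have ab: "norm (a x + b x) \<le> \<alpha> + \<beta>"
    using insert.prems by (intro norm_triangle_le add_mono) simp_all
  have p: "norm ?p \<le> (\<alpha> + \<beta>) ^ ?k"
  proof -
    have "norm ?p \<le> (\<Prod>i\<in>I. \<alpha> + \<beta>)"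
      unfolding prod_norm[symmetric] using insert.prems assms(5) by (intro prod_mono) force
    then show ?thesis by simp
  qed
  have "(\<Prod>i\<in>insert x I. a i + b i) - (\<Prod>i\<in>insert x I. a i) = (a x + b x) * (?P - ?p) + b x * ?p"
    using insert.hyps by (simp add: algebra_simps)
  also have "norm \<dots> \<le> norm (a x + b x) * norm (?P - ?p) + norm (b x) * norm ?p"
    by (rule order_trans[OF norm_triangle_ineq]) (simp add: norm_mult)
  \<comment> \<open>The bound on the unperturbed product is weakened by a factor \<alpha> + \<beta>
    \<ge> 1, so that both summands carry the same power.\<close>
  also have "\<dots> \<le> (\<alpha> + \<beta>) * (?k * \<beta> * (\<alpha> + \<beta>) ^ ?k) + \<beta> * ((\<alpha> + \<beta>) * (\<alpha> + \<beta>) ^ ?k)"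
  proof (intro add_mono mult_mono)
    have "1 * (\<alpha> + \<beta>) ^ ?k \<le> (\<alpha> + \<beta>) * (\<alpha> + \<beta>) ^ ?k"
      using assms(4,5) by (intro mult_right_mono) auto
    then show "norm ?p \<le> (\<alpha> + \<beta>) * (\<alpha> + \<beta>) ^ ?k"
      using p by simp
  qed (use ab IH insert.prems assms(4,5) in auto)
  also have "\<dots> = card (insert x I) * \<beta> * (\<alpha> + \<beta>) ^ card (insert x I)"
    using insert.hyps by (simp add: algebra_simps)
  finally show ?case .
qed simp

text \<open>When a factor a + b is added, the remainder after the linear part becomes a times the
  old remainder plus b times the old first-order difference. The latter is already of size \<beta>,
  so the extra b makes it quadratic. The count follows k^2 + k \<le> (k+1)^2.\<close>

lemma norm_prod_add_second_order_le:
  fixes a b :: "'i \<Rightarrow> complex" and \<alpha> \<beta> :: real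
  assumes "finite I" and "\<And>i. i \<in> I \<Longrightarrow> norm (a i) \<le> \<alpha>" and "\<And>i. i \<in> I \<Longrightarrow> norm (b i) \<le> \<beta>"
    and "1 \<le> \<alpha>" and "0 \<le> \<beta>"
  shows "norm ((\<Prod>i\<in>I. a i + b i) - (\<Prod>i\<in>I. a i) - (\<Sum>i\<in>I. \<Prod>k\<in>I. if k = i then b k else a k))
           \<le> (card I)\<^sup>2 * \<beta>\<^sup>2 * (\<alpha> + \<beta>) ^ card I"
  using assms(1-3)
proof (induction I rule: finite_induct)
  case (insert x I)
  let ?P = "\<lambda>I. \<Prod>i\<in>I. a i + b i" and ?p = "\<lambda>I. \<Prod>i\<in>I. a i"
  let ?s = "\<lambda>I. \<Sum>i\<in>I. \<Prod>k\<in>I. if k = i then b k else a k"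
  let ?k = "card I"
  have IH: "norm (?P I - ?p I - ?s I) \<le> ?k\<^sup>2 * \<beta>\<^sup>2 * (\<alpha> + \<beta>) ^ ?k"
    using insert by simp
  have first: "norm (?P I - ?p I) \<le> ?k * \<beta> * (\<alpha> + \<beta>) ^ ?k"
    using insert assms(4,5) by (intro norm_prod_add_diff_le) auto
  have "?s (insert x I) = b x * ?p I + (\<Sum>i\<in>I. \<Prod>k\<in>insert x I. if k = i then b k else a k)"
    using insert.hyps by (auto intro!: prod.cong arg_cong2[where f = "(*)"])
  also have "(\<Sum>i\<in>I. \<Prod>k\<in>insert x I. if k = i then b k else a k) = a x * ?s I"
    unfolding sum_distrib_left using insert.hyps by (intro sum.cong) auto
  finally have "?P (insert x I) - ?p (insert x I) - ?s (insert x I)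
      = a x * (?P I - ?p I - ?s I) + b x * (?P I - ?p I)"
    using insert.hyps by (simp add: algebra_simps)
  also have "norm \<dots> \<le> norm (a x) * norm (?P I - ?p I - ?s I) + norm (b x) * norm (?P I - ?p I)"
    by (rule order_trans[OF norm_triangle_ineq]) (simp add: norm_mult)
  also have "\<dots> \<le> (\<alpha> + \<beta>) * (?k\<^sup>2 * \<beta>\<^sup>2 * (\<alpha> + \<beta>) ^ ?k)
                  + \<beta> * ((\<alpha> + \<beta>) * (?k * \<beta> * (\<alpha> + \<beta>) ^ ?k))"
  proof (intro add_mono mult_mono)
    have "norm (a x) \<le> \<alpha>" using insert.prems by simp
    then show "norm (a x) \<le> \<alpha> + \<beta>" using assms(5) by simp
    have "1 * (?k * \<beta> * (\<alpha> + \<beta>) ^ ?k) \<le> (\<alpha> + \<beta>) * (?k * \<beta> * (\<alpha> + \<beta>) ^ ?k)"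
      using assms(4,5) by (intro mult_right_mono) auto
    then show "norm (?P I - ?p I) \<le> (\<alpha> + \<beta>) * (?k * \<beta> * (\<alpha> + \<beta>) ^ ?k)"
      using first by simp
  qed (use IH insert.prems assms(4,5) in auto)
  also have "\<dots> = ((real ?k)^2 + real ?k) * (\<beta>\<^sup>2 * (\<alpha> + \<beta>) ^ Suc ?k)"
    by (simp add: algebra_simps power2_eq_square)
  also have "\<dots> \<le> (real (Suc ?k))^2 * (\<beta>\<^sup>2 * (\<alpha> + \<beta>) ^ Suc ?k)"
    using assms(4,5) by (intro mult_right_mono) (auto simp: power2_eq_square algebra_simps)
  finally show ?case
    using insert.hyps by (simp add: mult.assoc)
qed simp

section \<open>The derivative of the determinant\<close>

definition replace_row :: "'a mat \<Rightarrow> 'a mat \<Rightarrow> nat \<Rightarrow> 'a mat" where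
  "replace_row A B i = mat (dim_row A) (dim_col A) (\<lambda>(k, j). if k = i then B $$ (k, j) else A $$ (k, j))"

text \<open>Differentiates by multilinearity in the rows instead of by a limit. Under the Leibniz
  formula this is the sum of products with one exchanged factor from the preceding lemma, and it is
  meaningful for singular \<open>A\<close>.\<close>

definition det_deriv :: "complex mat \<Rightarrow> complex mat \<Rightarrow> complex" where
  "det_deriv A B = (\<Sum>i<dim_row A. det (replace_row A B i))"

lemma replace_row_carrier [simp]: "A \<in> carrier_mat n m \<Longrightarrow> replace_row A B i \<in> carrier_mat n m"
  by (auto simp: replace_row_def)

lemma replace_row_index:
  "A \<in> carrier_mat n m \<Longrightarrow> k < n \<Longrightarrow> j < m \<Longrightarrow>
    replace_row A B i $$ (k, j) = (if k = i then B $$ (k, j) else A $$ (k, j))"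
  by (auto simp: replace_row_def)

text \<open>The product estimate is applied to each permutation separately; signs have modulus 1,
  and \<open>fact n\<close> counts the permutations.\<close>

lemma det_add_second_order_le:
  assumes A: "A \<in> carrier_mat n n" and B: "B \<in> carrier_mat n n"
    and "\<And>i j. i < n \<Longrightarrow> j < n \<Longrightarrow> cmod (A $$ (i, j)) \<le> \<alpha>"
    and "\<And>i j. i < n \<Longrightarrow> j < n \<Longrightarrow> cmod (B $$ (i, j)) \<le> \<beta>"
    and "1 \<le> \<alpha>" and "0 \<le> \<beta>"
  shows "cmod (det (A + B) - det A - det_deriv A B) \<le> fact n * (n\<^sup>2 * \<beta>\<^sup>2 * (\<alpha> + \<beta>) ^ n)"
proof -
  let ?Per = "{p. p permutes {0..<n}}"
  define K where "K = n\<^sup>2 * \<beta>\<^sup>2 * (\<alpha> + \<beta>) ^ n"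
  have AB: "A + B \<in> carrier_mat n n" using A B by simp
  have inj: "p i < n" if "p \<in> ?Per" "i < n" for p i
    using that permutes_in_image[of p "{0..<n}" i] by auto
  have expand: "det (A + B) - det A - det_deriv A B = (\<Sum>p\<in>?Per. signof p *
      ((\<Prod>i=0..<n. A $$ (i, p i) + B $$ (i, p i)) - (\<Prod>i=0..<n. A $$ (i, p i)) -
       (\<Sum>i=0..<n. \<Prod>k=0..<n. if k = i then B $$ (k, p k) else A $$ (k, p k))))"
  proof -
    have "det_deriv A B = (\<Sum>i=0..<n. \<Sum>p\<in>?Per. signof p *
        (\<Prod>k=0..<n. if k = i then B $$ (k, p k) else A $$ (k, p k)))"
      using A inj unfolding det_deriv_def atLeast0LessThan[symmetric]
      by (intro sum.cong)
        (auto simp: det_def'[OF replace_row_carrier[OF A]] replace_row_index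
          intro!: sum.cong arg_cong2[where f = "(*)"] prod.cong)
    also have "\<dots> = (\<Sum>p\<in>?Per. signof p *
        (\<Sum>i=0..<n. \<Prod>k=0..<n. if k = i then B $$ (k, p k) else A $$ (k, p k)))"
      by (subst sum.swap) (simp add: sum_distrib_left)
    moreover have "det (A + B) = (\<Sum>p\<in>?Per. signof p * (\<Prod>i=0..<n. A $$ (i, p i) + B $$ (i, p i)))"
      unfolding det_def'[OF AB] using A B inj by (auto intro!: sum.cong prod.cong)
    ultimately show ?thesis
      by (simp add: det_def'[OF A] sum_subtractf right_diff_distrib)
  qed
  have "cmod (det (A + B) - det A - det_deriv A B) \<le> (\<Sum>p\<in>?Per. K)"
    unfolding expand
  proof (rule sum_norm_le)
    fix p assume p: "p \<in> ?Per"
    show "cmod (signof p *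
      ((\<Prod>i=0..<n. A $$ (i, p i) + B $$ (i, p i)) - (\<Prod>i=0..<n. A $$ (i, p i)) -
       (\<Sum>i=0..<n. \<Prod>k=0..<n. if k = i then B $$ (k, p k) else A $$ (k, p k)))) \<le> K"
      using norm_prod_add_second_order_le[of "{0..<n}" "\<lambda>i. A $$ (i, p i)" \<alpha> "\<lambda>i. B $$ (i, p i)" \<beta>]
        inj[OF p] assms(3-) by (simp add: norm_mult sign_def K_def)
  qed
  also have "\<dots> = of_nat (card ?Per) * K"
    by (rule sum_constant)
  also have "card ?Per = fact n"
    by (rule card_permutations) auto
  finally show ?thesis by (simp add: K_def)
qed

text \<open>Expand the i-th summand along the exchanged row i: the minors omit that row, so they are
  minors of \<open>A\<close> itself.\<close>

lemma det_deriv_eq_cofactor: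
  assumes A: "A \<in> carrier_mat n n"
  shows "det_deriv A B = (\<Sum>i<n. \<Sum>j<n. B $$ (i, j) * cofactor A i j)"
proof -
  have "mat_delete (replace_row A B i) i j = mat_delete A i j" if "i < n" for i j
    using A that by (intro eq_matI) (auto simp: mat_delete_def replace_row_def)
  then show ?thesis
    using A unfolding det_deriv_def
    by (auto simp: laplace_expansion_row[OF replace_row_carrier[OF A]] cofactor_def
        replace_row_index intro!: sum.cong)
qed

lemma adj_mat_eq_inverse:
  assumes A: "A \<in> carrier_mat n n" and W: "W \<in> carrier_mat n n" and AW: "A * W = 1\<^sub>m n"
  shows "adj_mat A = det A \<cdot>\<^sub>m W"
proof -
  have "adj_mat A = adj_mat A * (A * W)"
    using adj_mat(1)[OF A] AW by simp
  also have "\<dots> = (adj_mat A * A) * W"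
    using adj_mat(1)[OF A] A W by simp
  also have "\<dots> = det A \<cdot>\<^sub>m W"
    using adj_mat(3)[OF A] W by (auto simp: mult_smult_assoc_mat[of _ n n])
  finally show ?thesis .
qed

text \<open>Jacobi's formula; the double sum is the trace of \<open>W * B\<close>.\<close>

lemma det_deriv_inverse:
  assumes A: "A \<in> carrier_mat n n" and W: "W \<in> carrier_mat n n" and AW: "A * W = 1\<^sub>m n"
  shows "det_deriv A B = det A * (\<Sum>i<n. \<Sum>j<n. W $$ (j, i) * B $$ (i, j))"
proof -
  have "cofactor A i j = det A * W $$ (j, i)" if "i < n" "j < n" for i j
    using arg_cong[OF adj_mat_eq_inverse[OF assms], of "\<lambda>M. M $$ (j, i)"] that A W
    by (simp add: adj_mat_def)
  then show ?thesis
    by (simp add: det_deriv_eq_cofactor[OF A] sum_distrib_left mult_ac)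
qed

subsection \<open>Rank-one updates\<close>

text \<open>The Leibniz formula is polynomial in the entries. This serves the limit argument for
  singular rank-one updates.\<close>

lemma isCont_det:
  fixes M :: "complex \<Rightarrow> complex mat"
  assumes "\<And>t. M t \<in> carrier_mat n n"
    and "\<And>i j. i < n \<Longrightarrow> j < n \<Longrightarrow> isCont (\<lambda>t. M t $$ (i, j)) x"
  shows "isCont (\<lambda>t. det (M t)) x"
proof -
  have "p i < n" if "p permutes {0..<n}" "i < n" for p i
    using that permutes_in_image[of p "{0..<n}" i] by auto
  then show ?thesis
    unfolding det_def'[OF assms(1)]
    by (intro continuous_sum continuous_mult continuous_prod assms(2) continuous_const) auto
qed

lemma outer_prod_carrier [simp]:
  "u \<in> carrier_vec n \<Longrightarrow> v \<in> carrier_vec m \<Longrightarrow> outer_prod u v \<in> carrier_mat n m"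
  by (auto simp: outer_prod_def)

lemma outer_prod_index [simp]:
  "i < dim_vec u \<Longrightarrow> j < dim_vec v \<Longrightarrow> outer_prod u v $$ (i, j) = u $ i * v $ j"
  by (auto simp: outer_prod_def)

lemma outer_prod_dim [simp]:
  "dim_row (outer_prod u v) = dim_vec u" "dim_col (outer_prod u v) = dim_vec v"
  by (auto simp: outer_prod_def)

lemma mult_outer_prod:
  assumes "M \<in> carrier_mat k n" and "u \<in> carrier_vec n"
  shows "M * outer_prod u v = outer_prod (M *\<^sub>v u) v"
  using assms by (intro eq_matI) (auto simp: scalar_prod_def sum_distrib_left mult_ac)

lemma outer_prod_mult:
  assumes "M \<in> carrier_mat n k" and "v \<in> carrier_vec n"
  shows "outer_prod u v * M = outer_prod u (transpose_mat M *\<^sub>v v)"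
  using assms by (intro eq_matI) (auto simp: scalar_prod_def sum_distrib_left mult_ac)

lemma outer_prod_mult_vec:
  assumes "w \<in> carrier_vec n" and "v \<in> carrier_vec n"
  shows "outer_prod u v *\<^sub>v w = (v \<bullet> w) \<cdot>\<^sub>v u"
  using assms by (intro eq_vecI) (auto simp: scalar_prod_def sum_distrib_left mult_ac)

lemma outer_prod_smult_left: "outer_prod (a \<cdot>\<^sub>v u) v = a \<cdot>\<^sub>m outer_prod u v"
  by (intro eq_matI) auto

text \<open>The matrix determinant lemma for an update confined to row 0, where the cofactors along
  that row do not change.\<close>

lemma det_add_first_row:
  assumes n: "0 < n" and A: "A \<in> carrier_mat n n" and W: "W \<in> carrier_mat n n"
    and AW: "A * W = 1\<^sub>m n" and c: "c \<in> carrier_vec n"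
  shows "det (A + outer_prod (unit_vec n 0) c) = det A * (1 + c \<bullet> (W *\<^sub>v unit_vec n 0))"
proof -
  let ?O = "outer_prod (unit_vec n 0) c"
  have A': "A + ?O \<in> carrier_mat n n" using A c by simp
  have adj: "adj_mat A = det A \<cdot>\<^sub>m W"
    by (rule adj_mat_eq_inverse[OF A W AW])
  have cof: "cofactor A 0 j = det A * W $$ (j, 0)" if "j < n" for j
    using arg_cong[OF adj, of "\<lambda>M. M $$ (j, 0)"] that n A W by (simp add: adj_mat_def)
  have "mat_delete (A + ?O) 0 j = mat_delete A 0 j" for j
    using A c by (intro eq_matI) (auto simp: mat_delete_def)
  then have "det (A + ?O) = (\<Sum>j<n. (A $$ (0, j) + c $ j) * cofactor A 0 j)"
    using n A c by (simp add: laplace_expansion_row[OF A' n] cofactor_def)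
  also have "\<dots> = det A + (\<Sum>j<n. c $ j * cofactor A 0 j)"
    by (simp add: laplace_expansion_row[OF A n] distrib_right sum.distrib)
  also have "(\<Sum>j<n. c $ j * cofactor A 0 j) = det A * (c \<bullet> (W *\<^sub>v unit_vec n 0))"
  proof -
    have "(W *\<^sub>v unit_vec n 0) $ j = W $$ (j, 0)" if "j < n" for j
      using that n W by (simp add: scalar_prod_right_unit)
    then show ?thesis
      using W c by (simp add: scalar_prod_def[of c] sum_distrib_left cof mult_ac atLeast0LessThan)
  qed
  finally show ?thesis by (simp add: algebra_simps)
qed

lemma sherman_morrison:
  assumes A: "A \<in> carrier_mat n n" and W: "W \<in> carrier_mat n n" and AW: "A * W = 1\<^sub>m n"
    and u: "u \<in> carrier_vec n" and v: "v \<in> carrier_vec n"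
    and nz: "1 + v \<bullet> (W *\<^sub>v u) \<noteq> 0"
  shows "(A + outer_prod u v) *
    (W - (1 / (1 + v \<bullet> (W *\<^sub>v u))) \<cdot>\<^sub>m outer_prod (W *\<^sub>v u) (transpose_mat W *\<^sub>v v)) = 1\<^sub>m n"
proof -
  define w where "w = W *\<^sub>v u"
  define z where "z = transpose_mat W *\<^sub>v v"
  define k where "k = 1 / (1 + v \<bullet> w)"
  have w: "w \<in> carrier_vec n" and z: "z \<in> carrier_vec n"
    using W u v by (auto simp: w_def z_def)
  have "A *\<^sub>v w = (A * W) *\<^sub>v u"
    using A W u by (simp add: w_def)
  then have Aw: "A *\<^sub>v w = u"
    using AW u by simp
  have "(A + outer_prod u v) * (W - k \<cdot>\<^sub>m outer_prod w z)
      = (A + outer_prod u v) * W - (A + outer_prod u v) * (k \<cdot>\<^sub>m outer_prod w z)"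
    using A W u v w z by (intro mult_minus_distrib_mat) auto
  also have "(A + outer_prod u v) * W = 1\<^sub>m n + outer_prod u z"
    using A W u v AW by (simp add: add_mult_distrib_mat[of _ n n] outer_prod_mult[of _ n n] z_def)
  also have "(A + outer_prod u v) * (k \<cdot>\<^sub>m outer_prod w z)
      = k \<cdot>\<^sub>m (outer_prod u z + outer_prod u v * outer_prod w z)"
  proof -
    have "(A + outer_prod u v) * (k \<cdot>\<^sub>m outer_prod w z) = k \<cdot>\<^sub>m ((A + outer_prod u v) * outer_prod w z)"
      using A u v w z by (intro mult_smult_distrib) auto
    also have "(A + outer_prod u v) * outer_prod w z = A * outer_prod w z + outer_prod u v * outer_prod w z"
      using A u v w z by (intro add_mult_distrib_mat) auto
    also have "A * outer_prod w z = outer_prod u z"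
      using A w by (simp add: mult_outer_prod[of _ n n] Aw)
    finally show ?thesis .
  qed
  also have "outer_prod u v * outer_prod w z = (v \<bullet> w) \<cdot>\<^sub>m outer_prod u z"
    using u v w z
    by (simp add: mult_outer_prod[of _ n n] outer_prod_mult_vec[of _ n] outer_prod_smult_left)
  also have "1\<^sub>m n + outer_prod u z - k \<cdot>\<^sub>m (outer_prod u z + (v \<bullet> w) \<cdot>\<^sub>m outer_prod u z) = 1\<^sub>m n"
    (is "?L = _")
  proof (rule eq_matI)
    fix i j assume "i < dim_row (1\<^sub>m n :: complex mat)" "j < dim_col (1\<^sub>m n :: complex mat)"
    then have "?L $$ (i, j) = 1\<^sub>m n $$ (i, j) + (1 - k * (1 + v \<bullet> w)) * (u $ i * z $ j)"
      using u z by (simp add: algebra_simps)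
    also have "1 - k * (1 + v \<bullet> w) = 0"
      using nz by (simp add: k_def w_def)
    finally show "?L $$ (i, j) = 1\<^sub>m n $$ (i, j)" by simp
  qed (use u z in auto)
  finally show ?thesis
    by (simp add: k_def w_def z_def)
qed

text \<open>When $A + e_1c^T$ is singular the Sherman--Morrison formula is not available; the identity is then
  the limit $t \to 1$ of the one for $A + t\,e_1c^T$.\<close>

lemma det_deriv_rank_one:
  assumes n: "0 < n" and A: "A \<in> carrier_mat n n" and W: "W \<in> carrier_mat n n"
    and AW: "A * W = 1\<^sub>m n" and c: "c \<in> carrier_vec n" and B: "B \<in> carrier_mat n n"
  shows "det_deriv (A + outer_prod (unit_vec n 0) c) B = det A *
    ((1 + c \<bullet> (W *\<^sub>v unit_vec n 0)) * (\<Sum>i<n. \<Sum>j<n. W $$ (j, i) * B $$ (i, j))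
      - (transpose_mat W *\<^sub>v c) \<bullet> (B *\<^sub>v (W *\<^sub>v unit_vec n 0)))"
proof -
  define w where "w = W *\<^sub>v unit_vec n 0"
  define A0 where "A0 = (\<lambda>t. A + outer_prod (unit_vec n 0) (t \<cdot>\<^sub>v c))"
  define T where "T = (\<Sum>i<n. \<Sum>j<n. W $$ (j, i) * B $$ (i, j))"
  define z where "z = transpose_mat W *\<^sub>v c"
  \<comment> \<open>The factor 1 + t (c . w) of \<open>det (A0 t)\<close> cancels the denominator of
    the Sherman-Morrison formula. What remains is polynomial in t and so extends to the singular
    parameter.\<close>
  define g where "g = (\<lambda>t. det A * ((1 + t * (c \<bullet> w)) * T - t * (z \<bullet> (B *\<^sub>v w))))"
  have w: "w \<in> carrier_vec n" and z: "z \<in> carrier_vec n"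
    using W c by (auto simp: w_def z_def)
  have A0: "A0 t \<in> carrier_mat n n" for t
    using A c by (simp add: A0_def)
  have generic: "det_deriv (A0 t) B = g t" if nz: "1 + t * (c \<bullet> w) \<noteq> 0" for t
  proof -
    define k where "k = 1 / (1 + t * (c \<bullet> w))"
    define X where "X = W - k \<cdot>\<^sub>m outer_prod w (t \<cdot>\<^sub>v z)"
    have X: "X \<in> carrier_mat n n" using w z unfolding X_def by (intro minus_carrier_mat smult_carrier_mat outer_prod_carrier) auto
    have dot: "(t \<cdot>\<^sub>v c) \<bullet> w = t * (c \<bullet> w)" using c w by simp
    have tz: "transpose_mat W *\<^sub>v (t \<cdot>\<^sub>v c) = t \<cdot>\<^sub>v z"
      using W c by (simp add: z_def mult_mat_vec[of _ n n])
    have inv: "A0 t * X = 1\<^sub>m n"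
      using sherman_morrison[OF A W AW, of "unit_vec n 0" "t \<cdot>\<^sub>v c"] nz c
      by (simp add: A0_def X_def k_def tz dot flip: w_def)
    have "det (A0 t) = det A * (1 + t * (c \<bullet> w))"
      using det_add_first_row[OF n A W AW, of "t \<cdot>\<^sub>v c"] c by (simp add: A0_def dot flip: w_def)
    then have "det_deriv (A0 t) B = det A * ((1 + t * (c \<bullet> w)) * (\<Sum>i<n. \<Sum>j<n. X $$ (j, i) * B $$ (i, j)))"
      by (simp add: det_deriv_inverse[OF A0 X inv])
    also have "(\<Sum>i<n. \<Sum>j<n. X $$ (j, i) * B $$ (i, j))
        = T - k * t * (\<Sum>i<n. \<Sum>j<n. z $ i * (B $$ (i, j) * w $ j))"
      using W w z unfolding T_def X_def
      by (simp add: sum_distrib_left algebra_simps sum_subtractf)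
    also have "(\<Sum>i<n. \<Sum>j<n. z $ i * (B $$ (i, j) * w $ j)) = z \<bullet> (B *\<^sub>v w)"
      using B w z by (simp add: scalar_prod_def sum_distrib_left atLeast0LessThan)
    also have "(1 + t * (c \<bullet> w)) * (T - k * t * (z \<bullet> (B *\<^sub>v w)))
        = (1 + t * (c \<bullet> w)) * T - ((1 + t * (c \<bullet> w)) * k) * (t * (z \<bullet> (B *\<^sub>v w)))"
      by (simp only: right_diff_distrib mult.assoc)
    also have "(1 + t * (c \<bullet> w)) * k = 1"
      using nz by (simp add: k_def)
    finally show ?thesis
      by (simp add: g_def)
  qed
  have "det_deriv (A0 1) B = g 1"
  proof (cases "1 + c \<bullet> w = 0")
    case False
    then show ?thesis using generic[of 1] by simp
  next
    case True
    then have cw: "c \<bullet> w = -1" by (simp add: add_eq_0_iff)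
    have "isCont (\<lambda>t. det_deriv (A0 t) B) 1"
    proof -
      have "isCont (\<lambda>t. replace_row (A0 t) B i $$ (k, j)) 1" if "i < n" "k < n" "j < n" for i k j
      proof -
        have "A0 t $$ (k, j) = A $$ (k, j) + unit_vec n 0 $ k * (t * c $ j)" for t
          using that A c by (simp add: A0_def)
        then show ?thesis
          unfolding replace_row_index[OF A0 that(2,3)] by (cases "k = i") (auto intro!: continuous_intros)
      qed
      then have "isCont (\<lambda>t. \<Sum>i<n. det (replace_row (A0 t) B i)) 1"
        by (intro continuous_sum isCont_det[of _ n] replace_row_carrier A0) auto
      moreover have "dim_row (A0 t) = n" for t using A0[of t] by simp
      ultimately show ?thesis by (simp add: det_deriv_def)
    qed
    then have "((\<lambda>t. det_deriv (A0 t) B) \<longlongrightarrow> det_deriv (A0 1) B) (at 1)"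
      by (simp add: isCont_def)
    \<comment> \<open>Since c . w = -1, the only exceptional parameter is t = 1, so the generic
      formula holds on the whole punctured neighbourhood.\<close>
    moreover have "\<forall>\<^sub>F t in at 1. det_deriv (A0 t) B = g t"
      unfolding eventually_at_filter by (auto intro!: always_eventually generic simp: cw)
    ultimately have "(g \<longlongrightarrow> det_deriv (A0 1) B) (at 1)"
      using Lim_transform_eventually by blast
    moreover have "(g \<longlongrightarrow> g 1) (at 1)"
      unfolding g_def by (intro tendsto_intros)
    ultimately show ?thesis
      using tendsto_unique[of "at (1::complex)"] by auto
  qed
  then show ?thesis
    by (simp add: A0_def g_def T_def flip: w_def z_def)
qed

subsection \<open>Euclidean norms\<close>

lemma vec_norm2_nonneg [simp]: "0 \<le> vec_norm2 v"
  by (simp add: vec_norm2_def L2_set_nonneg)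

lemma vec_norm2_smult: "vec_norm2 (a \<cdot>\<^sub>v v) = cmod a * vec_norm2 v"
  by (auto simp: vec_norm2_def norm_mult L2_set_right_distrib intro!: L2_set_cong)

lemma vec_norm2_mono:
  assumes "dim_vec v = dim_vec w" and "\<And>i. i < dim_vec w \<Longrightarrow> cmod (v $ i) \<le> cmod (w $ i)"
  shows "vec_norm2 v \<le> vec_norm2 w"
  using assms by (auto simp: vec_norm2_def intro!: L2_set_mono)

lemma vec_norm2_unit [simp]: "i < n \<Longrightarrow> vec_norm2 (unit_vec n i) = 1"
  unfolding vec_norm2_def L2_set_def by (simp add: if_distrib[of cmod] if_distrib[of "\<lambda>x. x\<^sup>2"] cong: if_cong)

lemma cmod_index_le_vec_norm2: "i < dim_vec v \<Longrightarrow> cmod (v $ i) \<le> vec_norm2 v"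
  unfolding vec_norm2_def by (rule member_le_L2_set) auto

lemma vec_norm2_eq_0D: "vec_norm2 v = 0 \<Longrightarrow> v = 0\<^sub>v (dim_vec v)"
  using cmod_index_le_vec_norm2[of _ v] by (intro eq_vecI) force+

lemma cmod_scalar_prod_le:
  assumes "dim_vec u = dim_vec v"
  shows "cmod (u \<bullet> v) \<le> vec_norm2 u * vec_norm2 v"
proof -
  have "cmod (u \<bullet> v) \<le> (\<Sum>i<dim_vec v. \<bar>cmod (u $ i)\<bar> * \<bar>cmod (v $ i)\<bar>)"
    unfolding scalar_prod_def atLeast0LessThan by (rule sum_norm_le) (simp add: norm_mult)
  also have "\<dots> \<le> vec_norm2 u * vec_norm2 v"
    unfolding vec_norm2_def assms by (rule L2_set_mult_ineq)
  finally show ?thesis .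
qed

text \<open>As \<open>\<bullet>\<close> does not conjugate, the Euclidean norm needs the conjugate
  written out.\<close>

lemma vec_norm2_cnj: "complex_of_real ((vec_norm2 v)\<^sup>2) = v \<bullet> map_vec cnj v"
proof -
  have "(vec_norm2 v)\<^sup>2 = (\<Sum>i<dim_vec v. (cmod (v $ i))\<^sup>2)"
    by (simp add: vec_norm2_def L2_set_def sum_nonneg)
  then show ?thesis
    by (simp add: scalar_prod_def atLeast0LessThan complex_norm_square del: of_real_power)
qed

lemma mat_norm2_bound:
  assumes B: "B \<in> carrier_mat n m" and v: "v \<in> carrier_vec m"
  shows "vec_norm2 (B *\<^sub>v v) \<le> mat_norm2 B * vec_norm2 v"
\<comment> \<open>The zero case also covers m = 0, where the supremum defining
  \<open>mat_norm2\<close> is over an empty set.\<close>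
proof (cases "vec_norm2 v = 0")
  case True
  then have "v = 0\<^sub>v m" using vec_norm2_eq_0D[OF True] v by simp
  then have "B *\<^sub>v v = 0\<^sub>v n" using B by auto
  then show ?thesis using True by (simp add: vec_norm2_def L2_set_def)
next
  case False
  then have pos: "vec_norm2 v > 0" by (simp add: less_le)
  let ?u = "complex_of_real (1 / vec_norm2 v) \<cdot>\<^sub>v v"
  have u: "?u \<in> carrier_vec m" "vec_norm2 ?u = 1"
    using v pos by (auto simp: vec_norm2_smult norm_divide)
  \<comment> \<open>A crude bound by the sum of all entries; it makes the set under the supremum
    bounded above, as \<open>cSUP_upper\<close> requires.\<close>
  have "vec_norm2 (B *\<^sub>v w) \<le> (\<Sum>i<n. \<Sum>j<m. cmod (B $$ (i, j)))"
    if w: "w \<in> carrier_vec m" "vec_norm2 w = 1" for w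
  proof -
    have "vec_norm2 (B *\<^sub>v w) \<le> (\<Sum>i<n. cmod ((B *\<^sub>v w) $ i))"
      unfolding vec_norm2_def using B by (intro order.trans[OF L2_set_le_sum]) auto
    also have "\<dots> \<le> (\<Sum>i<n. \<Sum>j<m. cmod (B $$ (i, j)))"
    proof (rule sum_mono)
      fix i assume i: "i \<in> {..<n}"
      have "cmod ((B *\<^sub>v w) $ i) = cmod (\<Sum>j<m. B $$ (i, j) * w $ j)"
        using i B w by (simp add: scalar_prod_def atLeast0LessThan)
      also have "\<dots> \<le> (\<Sum>j<m. cmod (B $$ (i, j)))"
      proof (rule sum_norm_le)
        fix j assume "j \<in> {..<m}"
        then have "cmod (w $ j) \<le> 1" using cmod_index_le_vec_norm2[of j w] w by simp
        then show "cmod (B $$ (i, j) * w $ j) \<le> cmod (B $$ (i, j))"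
          by (simp add: norm_mult mult_left_le)
      qed
      finally show "cmod ((B *\<^sub>v w) $ i) \<le> (\<Sum>j<m. cmod (B $$ (i, j)))" .
    qed
    finally show ?thesis .
  qed
  then have "bdd_above ((\<lambda>w. vec_norm2 (B *\<^sub>v w)) ` {w \<in> carrier_vec (dim_col B). vec_norm2 w = 1})"
    using B by (intro bdd_aboveI2) auto
  then have "vec_norm2 (B *\<^sub>v ?u) \<le> mat_norm2 B"
    unfolding mat_norm2_def using u B by (intro cSUP_upper) auto
  then have "vec_norm2 (B *\<^sub>v v) / vec_norm2 v \<le> mat_norm2 B"
    using B v pos by (simp add: mult_mat_vec[of _ n m] vec_norm2_smult norm_divide)
  then show ?thesis
    using pos by (simp add: divide_le_eq)
qed

lemma cmod_index_le_mat_norm2: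
  assumes B: "B \<in> carrier_mat n m" and "i < n" "j < m"
  shows "cmod (B $$ (i, j)) \<le> mat_norm2 B"
proof -
  have "B $$ (i, j) = (B *\<^sub>v unit_vec m j) $ i"
    using assms by simp
  also have "cmod \<dots> \<le> vec_norm2 (B *\<^sub>v unit_vec m j)"
    using assms by (intro cmod_index_le_vec_norm2) auto
  also have "\<dots> \<le> mat_norm2 B"
    using mat_norm2_bound[OF B, of "unit_vec m j"] assms by simp
  finally show ?thesis .
qed

text \<open>Reality of \<open>U\<close> lets conjugation pass through it, so orthogonality with
  respect to the bilinear product acts as unitarity on complex vectors.\<close>

lemma vec_norm2_orthogonal:
  assumes U: "U \<in> carrier_mat n n" and UU: "transpose_mat U * U = 1\<^sub>m n"
    and real: "\<And>i j. i < n \<Longrightarrow> j < n \<Longrightarrow> cnj (U $$ (i, j)) = U $$ (i, j)"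
    and v: "v \<in> carrier_vec n"
  shows "vec_norm2 (U *\<^sub>v v) = vec_norm2 v"
proof -
  let ?v = "map_vec cnj v"
  have vc: "?v \<in> carrier_vec n" using v by simp
  have "map_vec cnj (U *\<^sub>v v) = U *\<^sub>v ?v"
    using U v real by (intro eq_vecI) (auto simp: scalar_prod_def)
  then have "complex_of_real ((vec_norm2 (U *\<^sub>v v))\<^sup>2) = (U *\<^sub>v v) \<bullet> (U *\<^sub>v ?v)"
    by (simp add: vec_norm2_cnj del: of_real_power)
  also have "\<dots> = (transpose_mat U *\<^sub>v (U *\<^sub>v v)) \<bullet> ?v"
    using U v vc by (intro transpose_vec_mult_scalar[symmetric]) auto
  also have "transpose_mat U *\<^sub>v (U *\<^sub>v v) = (transpose_mat U * U) *\<^sub>v v"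
    using U v by simp
  also have "\<dots> = v" using UU v by simp
  also have "v \<bullet> ?v = complex_of_real ((vec_norm2 v)\<^sup>2)"
    by (simp add: vec_norm2_cnj del: of_real_power)
  finally have "(vec_norm2 (U *\<^sub>v v))\<^sup>2 = (vec_norm2 v)\<^sup>2"
    by (simp only: of_real_eq_iff)
  then show ?thesis
    by (simp add: power2_eq_iff_nonneg)
qed

lemma poly_char_poly:
  assumes "A \<in> carrier_mat n n"
  shows "poly (char_poly A) x = det (x \<cdot>\<^sub>m 1\<^sub>m n - A)"
  unfolding char_poly_def
  by (rule poly_det_cong[of _ n]) (use assms in \<open>auto simp: char_poly_matrix_def\<close>)

subsection \<open>Spectral decomposition of the associated matrix\<close>

text \<open>\<open>r\<close> lists the roots with multiplicity and as complex numbers. That they are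
  real and distinct is derived in this locale.\<close>

locale symmetric_basis =
  fixes n :: nat and \<phi> :: "nat \<Rightarrow> real poly" and H :: "real mat" and r :: "nat \<Rightarrow> complex"
  assumes n: "1 \<le> n"
    and degree_basis: "\<And>j. j \<le> n \<Longrightarrow> degree (\<phi> j) = j"
    and lead_basis: "\<And>j. j \<le> n \<Longrightarrow> 0 < lead_coeff (\<phi> j)"
    and assoc: "associated_matrix n \<phi> H"
    and symmetric: "transpose_mat H = H"
    and roots: "proots (cpoly (\<phi> n)) = image_mset r (mset_set {1..n})"
begin

abbreviation "\<Phi> \<equiv> basis_vec n \<phi>"
abbreviation "\<chi> \<equiv> lead_ratio n \<phi>"
abbreviation "\<nu> \<equiv> complex_of_real (lead_coeff (\<phi> n))"
abbreviation "f \<equiv> poly (cpoly (\<phi> n))"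

lemma chi_pos: "0 < \<chi>"
  using lead_basis[of n] lead_basis[of "n - 1"] by (simp add: lead_ratio_def)

lemma nu_nonzero: "\<nu> \<noteq> 0"
  using lead_basis[of n] by (metis less_irrefl of_real_eq_0_iff order_refl)

lemma top_nonzero: "cpoly (\<phi> n) \<noteq> 0"
  using nu_nonzero by (auto simp: map_poly_eq_0_iff)

lemma H_carrier: "cmat H \<in> carrier_mat n n"
  using assoc by (simp add: associated_matrix_def)

lemma H_dim [simp]: "dim_row H = n" "dim_col H = n"
  using assoc by (auto simp: associated_matrix_def)

lemma Phi_carrier: "\<Phi> x \<in> carrier_vec n"
  by (simp add: basis_vec_def)

lemma H_Phi: "cmat H *\<^sub>v \<Phi> x = x \<cdot>\<^sub>v \<Phi> x - (f x / complex_of_real \<chi>) \<cdot>\<^sub>v unit_vec n 0"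
  using assoc by (simp add: associated_matrix_def)

text \<open>Evaluate Phi(x)^T H Phi(y) by letting the symmetric H act on either side. The e_1 terms
  pick out entry 0 of \<open>\<Phi>\<close>, which is the value of phi_{n-1}. Bilinearity makes this
  valid for all complex x and y.\<close>

lemma christoffel_darboux:
  "(x - y) * (\<Phi> x \<bullet> \<Phi> y)
    = (f x * \<Phi> y $ 0 - f y * \<Phi> x $ 0) / complex_of_real \<chi>"
proof -
  have dot: "\<Phi> x \<bullet> (cmat H *\<^sub>v \<Phi> y) = y * (\<Phi> x \<bullet> \<Phi> y) - f y / complex_of_real \<chi> * \<Phi> x $ 0" for x y
    using n Phi_carrier[of x] Phi_carrier[of y] unfolding H_Phi
    by (subst scalar_prod_minus_distrib[of _ n]) auto
  have comm: "u \<bullet> v = v \<bullet> u" if "u \<in> carrier_vec n" "v \<in> carrier_vec n" for u v :: "complex Matrix.vec"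
    using that by (rule comm_scalar_prod)
  have "transpose_mat (cmat H) = cmat (transpose_mat H)"
    by (intro eq_matI) auto
  then have "transpose_mat (cmat H) = cmat H"
    by (simp only: symmetric)
  then have "(cmat H *\<^sub>v \<Phi> x) \<bullet> \<Phi> y = \<Phi> x \<bullet> (cmat H *\<^sub>v \<Phi> y)"
    using transpose_vec_mult_scalar[OF H_carrier Phi_carrier[of y] Phi_carrier[of x]] by simp
  then have "\<Phi> y \<bullet> (cmat H *\<^sub>v \<Phi> x) = \<Phi> x \<bullet> (cmat H *\<^sub>v \<Phi> y)"
    using comm[of "\<Phi> y" "cmat H *\<^sub>v \<Phi> x"] H_carrier Phi_carrier by simp
  then show ?thesis
    unfolding dot comm[OF Phi_carrier[of y] Phi_carrier[of x]]
    by (simp add: algebra_simps diff_divide_distrib)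
qed

section \<open>Reality, simplicity and orthogonality at the roots\<close>

lemma cnj_poly_cpoly: "cnj (poly (cpoly p) x) = poly (cpoly p) (cnj x)"
  by (rule poly_cnj_real) (simp add: coeff_map_poly)

lemma Phi_cnj: "\<Phi> (cnj x) = map_vec cnj (\<Phi> x)"
  by (intro eq_vecI) (simp_all add: basis_vec_def cnj_poly_cpoly)

text \<open>The last entry of \<open>\<Phi> x\<close> is the nonzero constant phi_0.\<close>

lemma norm_Phi_pos: "0 < vec_norm2 (\<Phi> x)"
proof -
  obtain a where a: "\<phi> 0 = [:a:]"
    using degree_basis[of 0] by (auto elim: degree_eq_zeroE)
  have "a \<noteq> 0" using lead_basis[of 0] a by auto
  then have "0 < cmod (\<Phi> x $ (n - 1))"
    using n a by (simp add: basis_vec_def map_poly_pCons)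
  also have "\<dots> \<le> vec_norm2 (\<Phi> x)"
    using n by (intro cmod_index_le_vec_norm2) (simp add: basis_vec_def)
  finally show ?thesis .
qed

lemma root_iff: "f x = 0 \<longleftrightarrow> x \<in> r ` {1..n}"
proof -
  have "f x = 0 \<longleftrightarrow> x \<in># proots (cpoly (\<phi> n))"
    using top_nonzero by (simp add: set_count_proots)
  then show ?thesis by (simp add: roots)
qed

text \<open>Put y = cnj x in the Christoffel-Darboux identity: the right side vanishes, and the
  bilinear product on the left becomes the squared norm of the nonzero vector
  \<open>\<Phi> x\<close>.\<close>

lemma root_real:
  assumes "f x = 0"
  shows "cnj x = x"
proof -
  have "f (cnj x) = 0" using assms by (metis cnj_poly_cpoly complex_cnj_zero)
  then have "(x - cnj x) * complex_of_real ((vec_norm2 (\<Phi> x))\<^sup>2) = 0"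
    using christoffel_darboux[of x "cnj x"] assms
    by (simp add: vec_norm2_cnj Phi_cnj del: of_real_power)
  then show ?thesis
    using norm_Phi_pos[of x] by auto
qed

lemma Phi_root_self: "f x = 0 \<Longrightarrow> \<Phi> x \<bullet> \<Phi> x = complex_of_real ((vec_norm2 (\<Phi> x))\<^sup>2)"
  using Phi_cnj[of x] by (simp add: vec_norm2_cnj root_real del: of_real_power)

lemma Phi_roots_orthogonal: "f x = 0 \<Longrightarrow> f y = 0 \<Longrightarrow> x \<noteq> y \<Longrightarrow> \<Phi> x \<bullet> \<Phi> y = 0"
  using christoffel_darboux[of x y] by simp

text \<open>If $s$ were a double root, dividing the Christoffel--Darboux identity by $x - s$ would give
  $\Phi(s)^T\Phi(s) = 0$, although $\Phi(s)$ is real and nonzero.\<close>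

lemma order_root:
  assumes s: "f s = 0"
  shows "order s (cpoly (\<phi> n)) \<le> 1"
proof (rule ccontr)
  assume "\<not> ?thesis"
  then have "[:-s, 1:] ^ 2 dvd cpoly (\<phi> n)"
    using order_divides[of s 2 "cpoly (\<phi> n)"] by simp
  then obtain g where g: "cpoly (\<phi> n) = [:-s, 1:] ^ 2 * g" by (auto elim: dvdE)
  \<comment> \<open>With f s = 0 the Christoffel-Darboux identity reads (x - s) K(x) = k f(x), where
    K(x) is \<open>\<Phi> x \<bullet> \<Phi> s\<close>. It is lifted to polynomials because the
    factor x - s must be cancelled and the result then evaluated at s.\<close>
  define k where "k = \<Phi> s $ 0 / complex_of_real \<chi>"
  define K where "K = (\<Sum>i<n. Polynomial.smult (\<Phi> s $ i) (cpoly (\<phi> (n - 1 - i))))"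
  have K: "poly K x = \<Phi> x \<bullet> \<Phi> s" for x
    by (simp add: K_def poly_sum scalar_prod_def basis_vec_def atLeast0LessThan mult_ac)
  have "poly ([:-s, 1:] * K) x = poly ([:-s, 1:] * ([:-s, 1:] * Polynomial.smult k g)) x" for x
  proof -
    have "(x - s) * poly K x = k * f x"
      using christoffel_darboux[of x s] s by (simp add: K k_def)
    then show ?thesis
      by (simp add: g power2_eq_square algebra_simps)
  qed
  then have "[:-s, 1:] * K = [:-s, 1:] * ([:-s, 1:] * Polynomial.smult k g)"
    by (intro poly_ext)
  then have "K = [:-s, 1:] * Polynomial.smult k g"
    by (subst (asm) mult_cancel_left) auto
  then have "poly K s = 0" by simp
  then show False
    using K[of s] Phi_root_self[OF s] norm_Phi_pos[of s] by simp
qed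

text \<open>Two indices with the same value would both count towards the multiplicity of that root,
  which \<open>order_root\<close> limits to 1.\<close>

lemma inj_roots: "inj_on r {1..n}"
proof (rule inj_onI, rule ccontr)
  fix i j assume ij: "i \<in> {1..n}" "j \<in> {1..n}" "r i = r j" "i \<noteq> j"
  have s: "f (r i) = 0" using ij by (simp add: root_iff)
  have "{i, j} \<subseteq> r -` {r i} \<inter> {1..n}" using ij by auto
  then have "card {i, j} \<le> card (r -` {r i} \<inter> {1..n})"
    by (intro card_mono) auto
  also have "\<dots> = order (r i) (cpoly (\<phi> n))"
    using top_nonzero
    by (auto simp: count_image_mset' roots intro!: arg_cong[of _ _ card] simp flip: count_proots)
  finally show False
    using order_root[OF s] ij by simp
qed

text \<open>The columns are the normalised eigenvectors. Columns are numbered from 0 and roots from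
  1, hence \<open>Suc j\<close>.\<close>

definition Q :: "complex mat" where
  "Q = mat n n (\<lambda>(i, j). \<Phi> (r (Suc j)) $ i / complex_of_real (vec_norm2 (\<Phi> (r (Suc j)))))"

lemma Q_carrier [simp]: "Q \<in> carrier_mat n n"
  by (simp add: Q_def)

lemma Q_dim [simp]: "dim_row Q = n" "dim_col Q = n"
  by (simp_all add: Q_def)

lemma root_Suc: "j < n \<Longrightarrow> f (r (Suc j)) = 0"
  by (auto simp: root_iff)

lemma Q_real: "i < n \<Longrightarrow> j < n \<Longrightarrow> cnj (Q $$ (i, j)) = Q $$ (i, j)"
  using Phi_cnj[of "r (Suc j)"] root_real[OF root_Suc[of j]] Phi_carrier[of "r (Suc j)"]
  by (simp add: Q_def) (metis carrier_vecD index_map_vec(1))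

lemma Q_col: "j < n \<Longrightarrow> col Q j = complex_of_real (1 / vec_norm2 (\<Phi> (r (Suc j)))) \<cdot>\<^sub>v \<Phi> (r (Suc j))"
  using Phi_carrier[of "r (Suc j)"] by (intro eq_vecI) (auto simp: Q_def)

lemma Q_orthogonal: "transpose_mat Q * Q = 1\<^sub>m n"
proof (rule eq_matI)
  fix i j assume "i < dim_row (1\<^sub>m n :: complex mat)" "j < dim_col (1\<^sub>m n :: complex mat)"
  then have ij: "i < n" "j < n" by auto
  let ?x = "r (Suc i)" and ?y = "r (Suc j)"
  have "(transpose_mat Q * Q) $$ (i, j) = col Q i \<bullet> col Q j"
    using ij by (simp add: Q_def)
  also have "\<dots> = \<Phi> ?x \<bullet> \<Phi> ?y / (vec_norm2 (\<Phi> ?x) * vec_norm2 (\<Phi> ?y))"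
    using Phi_carrier[of ?x] Phi_carrier[of ?y] by (simp add: Q_col ij)
  also have "\<dots> = 1\<^sub>m n $$ (i, j)"
  proof (cases "i = j")
    case True
    then show ?thesis
      using norm_Phi_pos[of ?x] ij Phi_root_self[OF root_Suc[of i]] by (simp add: power2_eq_square)
  next
    case False
    then have "?x \<noteq> ?y" using inj_onD[OF inj_roots, of "Suc i" "Suc j"] ij by auto
    then show ?thesis
      using Phi_roots_orthogonal[OF root_Suc[of i] root_Suc[of j]] ij False by simp
  qed
  finally show "(transpose_mat Q * Q) $$ (i, j) = 1\<^sub>m n $$ (i, j)" .
qed auto

lemma Q_orthogonal': "Q * transpose_mat Q = 1\<^sub>m n"
  by (rule mat_mult_left_right_inverse[OF _ _ Q_orthogonal]) auto

text \<open>The inverse of xI - H in spectral form. At a root of phi_n the quotient takes the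
  default value 0 and this is no inverse, hence the assumption \<open>nonroot\<close> further
  down.\<close>

definition resolvent :: "complex \<Rightarrow> complex mat" where
  "resolvent x = Q * mat_diag n (\<lambda>j. 1 / (x - r (Suc j))) * transpose_mat Q"

lemma resolvent_carrier [simp]: "resolvent x \<in> carrier_mat n n"
  unfolding resolvent_def by (intro mult_carrier_mat[of _ n n]) auto

abbreviation shifted :: "complex \<Rightarrow> complex mat" where
  "shifted x \<equiv> x \<cdot>\<^sub>m 1\<^sub>m n - cmat H"

lemma shifted_carrier [simp]: "shifted x \<in> carrier_mat n n"
  using H_carrier by (intro minus_carrier_mat)

lemma shifted_mult_vec:
  assumes "v \<in> carrier_vec n"
  shows "shifted x *\<^sub>v v = x \<cdot>\<^sub>v v - cmat H *\<^sub>v v"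
proof -
  have "(x \<cdot>\<^sub>m 1\<^sub>m n) *\<^sub>v v = x \<cdot>\<^sub>v v"
    using assms by (intro eq_vecI) auto
  then show ?thesis
    using minus_mult_distrib_mat_vec[OF smult_carrier_mat[OF one_carrier_mat] H_carrier assms] by simp
qed

lemma shifted_Phi: "shifted x *\<^sub>v \<Phi> x = (f x / complex_of_real \<chi>) \<cdot>\<^sub>v unit_vec n 0"
  unfolding shifted_mult_vec[OF Phi_carrier] H_Phi
  using Phi_carrier[of x] by (intro eq_vecI) auto

text \<open>At a root of phi_n the e_1 term in \<open>H_Phi\<close> vanishes, so each column of
  \<open>Q\<close> is an eigenvector.\<close>

lemma shifted_diagonal: "shifted x * Q = Q * mat_diag n (\<lambda>j. x - r (Suc j))"
proof (rule mat_col_eqI)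
  fix j assume "j < dim_col (Q * mat_diag n (\<lambda>j. x - r (Suc j)))"
  then have j: "j < n" by (simp add: mat_diag_def)
  let ?P = "\<Phi> (r (Suc j))"
  have "col (shifted x * Q) j = shifted x *\<^sub>v col Q j"
    by (rule col_mult2[OF shifted_carrier Q_carrier j])
  also have "\<dots> = (x - r (Suc j)) \<cdot>\<^sub>v col Q j"
  proof -
    have "shifted x *\<^sub>v ?P = (x - r (Suc j)) \<cdot>\<^sub>v ?P"
      unfolding shifted_mult_vec[OF Phi_carrier] H_Phi
      using Phi_carrier[of "r (Suc j)"] root_Suc[OF j] by (intro eq_vecI) (auto simp: algebra_simps)
    then show ?thesis
      using Phi_carrier[of "r (Suc j)"] j
      by (simp add: Q_col mult_mat_vec[OF shifted_carrier] smult_smult_assoc mult.commute)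
  qed
  also have "\<dots> = col (Q * mat_diag n (\<lambda>j. x - r (Suc j))) j"
    using j by (intro eq_vecI) (auto simp: mat_diag_mult_right[of _ n n] mult.commute)
  finally show "col (shifted x * Q) j = col (Q * mat_diag n (\<lambda>j. x - r (Suc j))) j" .
qed (auto simp: mat_diag_def)

text \<open>Take determinants in \<open>shifted_diagonal\<close> and cancel det Q. The remaining
  product runs over the roots with multiplicity, so scaling by the leading coefficient restores the
  factorisation of phi_n.\<close>

lemma det_shifted: "\<nu> * det (shifted x) = f x"
proof -
  have "det Q \<noteq> 0"
    using arg_cong[OF Q_orthogonal, of det] det_mult[of "transpose_mat Q" n Q] by auto
  moreover have "det (mat_diag n (\<lambda>j. x - r (Suc j))) = (\<Prod>j<n. x - r (Suc j))"
    by (subst det_upper_triangular[of _ n])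
      (auto simp: mat_diag_def upper_triangular_def diag_mat_def prod.list_conv_set_nth atLeast0LessThan)
  ultimately have "det (shifted x) = (\<Prod>j<n. x - r (Suc j))"
    using arg_cong[OF shifted_diagonal, of det x] det_mult[OF shifted_carrier Q_carrier, of x]
      det_mult[OF Q_carrier mat_diag_dim, of "\<lambda>j. x - r (Suc j)"] by simp
  also have "\<dots> = (\<Prod>j=1..n. x - r j)"
    by (rule prod.reindex_bij_witness[of _ "\<lambda>j. j - 1" Suc]) auto
  also have "\<nu> * \<dots> = poly (Polynomial.smult (lead_coeff (cpoly (\<phi> n))) (\<Prod>z\<in>#proots (cpoly (\<phi> n)). [:-z, 1:])) x"
    by (simp add: roots poly_prod_mset image_mset.compositionality comp_def prod_unfold_prod_mset
        degree_map_poly coeff_map_poly)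
  also have "\<dots> = f x"
    by (simp only: complex_poly_decompose_multiset)
  finally show ?thesis .
qed

section \<open>The resolvent away from the roots\<close>

context
  fixes x :: complex
  assumes nonroot: "f x \<noteq> 0"
begin

lemma nonroot_diff: "j < n \<Longrightarrow> x - r (Suc j) \<noteq> 0"
  using nonroot root_Suc by auto

lemma shifted_resolvent: "shifted x * resolvent x = 1\<^sub>m n"
proof -
  let ?D = "mat_diag n (\<lambda>j. x - r (Suc j))" and ?E = "mat_diag n (\<lambda>j. 1 / (x - r (Suc j)))"
  have "shifted x * resolvent x = shifted x * Q * ?E * transpose_mat Q"
    unfolding resolvent_def
    by (simp only: assoc_mult_mat[OF shifted_carrier Q_carrier mat_diag_dim]
        assoc_mult_mat[OF shifted_carrier mult_carrier_mat[OF Q_carrier mat_diag_dim]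
          transpose_carrier_mat[THEN iffD2, OF Q_carrier]])
  also have "\<dots> = Q * (?D * ?E) * transpose_mat Q"
    unfolding shifted_diagonal by (subst assoc_mult_mat[of Q n n _ n _ n]) auto
  also have "?D * ?E = 1\<^sub>m n"
    unfolding mat_diag_diag using nonroot_diff by (intro eq_matI) (auto simp: mat_diag_def)
  finally show ?thesis
    by (simp add: Q_orthogonal' right_mult_one_mat[OF Q_carrier])
qed

text \<open>Apply the resolvent to \<open>shifted_Phi\<close>, which exhibits
  \<open>\<Phi> x\<close> as the preimage of a multiple of e_1.\<close>

lemma resolvent_unit: "resolvent x *\<^sub>v unit_vec n 0 = (complex_of_real \<chi> / f x) \<cdot>\<^sub>v \<Phi> x"
proof -
  have inv: "resolvent x * shifted x = 1\<^sub>m n"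
    by (rule mat_mult_left_right_inverse[OF _ _ shifted_resolvent]) auto
  have "\<Phi> x = resolvent x *\<^sub>v (shifted x *\<^sub>v \<Phi> x)"
    using assoc_mult_mat_vec[OF resolvent_carrier shifted_carrier Phi_carrier, of x x x] Phi_carrier[of x]
    by (simp add: inv)
  also have "\<dots> = (f x / complex_of_real \<chi>) \<cdot>\<^sub>v (resolvent x *\<^sub>v unit_vec n 0)"
    unfolding shifted_Phi by (rule mult_mat_vec[OF resolvent_carrier]) simp
  finally show ?thesis
    using nonroot chi_pos by (simp add: smult_smult_assoc)
qed

text \<open>Both \<open>Q\<close> and its transpose preserve Euclidean norms, so only the largest
  diagonal entry of the spectral form matters.\<close>

lemma resolvent_norm:
  assumes v: "v \<in> carrier_vec n"
  shows "vec_norm2 (resolvent x *\<^sub>v v) \<le> root_max n r x * vec_norm2 v"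
proof -
  let ?E = "mat_diag n (\<lambda>j. 1 / (x - r (Suc j)))"
  let ?y = "transpose_mat Q *\<^sub>v v"
  have y: "?y \<in> carrier_vec n" using v by (intro mult_mat_vec_carrier[of _ n n]) auto
  have M: "1 / cmod (x - r (Suc j)) \<le> root_max n r x" if "j < n" for j
    unfolding root_max_def using that by (intro Max_ge) auto
  have M0: "0 \<le> root_max n r x" using order.trans[OF _ M[of 0]] n by simp
  have "resolvent x *\<^sub>v v = Q *\<^sub>v (?E *\<^sub>v ?y)"
    unfolding resolvent_def using v y
    by (simp add: assoc_mult_mat_vec[of _ n n _ n] mult_carrier_mat[of _ n n])
  then have "vec_norm2 (resolvent x *\<^sub>v v) = vec_norm2 (?E *\<^sub>v ?y)"
    using y Q_real by (simp add: vec_norm2_orthogonal[OF Q_carrier Q_orthogonal] mult_mat_vec_carrier[of _ n n])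
  also have "\<dots> \<le> vec_norm2 (complex_of_real (root_max n r x) \<cdot>\<^sub>v ?y)"
  proof (rule vec_norm2_mono)
    fix i assume "i < dim_vec (complex_of_real (root_max n r x) \<cdot>\<^sub>v ?y)"
    then have i: "i < n" using y by simp
    have "(?E *\<^sub>v ?y) $ i = (\<Sum>j<n. (if i = j then 1 / (x - r (Suc j)) else 0) * ?y $ j)"
      using i y by (simp add: scalar_prod_def mat_diag_def atLeast0LessThan)
    also have "\<dots> = ?y $ i / (x - r (Suc i))"
      using i by (simp add: if_distrib[of "\<lambda>x. x * _"] cong: if_cong)
    also have "cmod \<dots> = 1 / cmod (x - r (Suc i)) * cmod (?y $ i)"
      by (simp add: norm_divide)
    also have "\<dots> \<le> root_max n r x * cmod (?y $ i)"
      by (intro mult_right_mono M i) simp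
    finally show "cmod ((?E *\<^sub>v ?y) $ i) \<le> cmod ((complex_of_real (root_max n r x) \<cdot>\<^sub>v ?y) $ i)"
      using i y M0 by (simp add: norm_mult)
  qed (simp_all add: mat_diag_def)
  also have "\<dots> = root_max n r x * vec_norm2 v"
  proof -
    have "vec_norm2 ?y = vec_norm2 v"
      using Q_real Q_orthogonal' v by (intro vec_norm2_orthogonal) auto
    then show ?thesis using M0 by (simp add: vec_norm2_smult)
  qed
  finally show ?thesis .
qed

lemma resolvent_index:
  assumes "i < n" "j < n"
  shows "resolvent x $$ (i, j) = (\<Sum>k<n. Q $$ (i, k) * Q $$ (j, k) / (x - r (Suc k)))"
  unfolding resolvent_def using assms
  by (subst mat_diag_mult_right[OF Q_carrier]) (auto simp: scalar_prod_def atLeast0LessThan intro!: sum.cong)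

lemma resolvent_symmetric: "transpose_mat (resolvent x) = resolvent x"
proof -
  have "dim_row (resolvent x) = n" "dim_col (resolvent x) = n"
    by (rule carrier_matD[OF resolvent_carrier])+
  then show ?thesis
    by (intro eq_matI) (auto simp: resolvent_index mult.commute)
qed

text \<open>By cyclicity the trace of WB is the sum of q_k^T B q_k / (x - r_k) over the columns q_k
  of \<open>Q\<close>. Each q_k is real of norm 1, so each numerator is at most the spectral norm of
  B.\<close>

lemma resolvent_trace:
  assumes B: "B \<in> carrier_mat n n"
  shows "cmod (\<Sum>i<n. \<Sum>j<n. resolvent x $$ (j, i) * B $$ (i, j)) \<le> root_sum n r x * mat_norm2 B"
proof -
  have "(\<Sum>i<n. \<Sum>j<n. resolvent x $$ (j, i) * B $$ (i, j))
      = (\<Sum>i<n. \<Sum>j<n. \<Sum>k<n. Q $$ (j, k) * Q $$ (i, k) / (x - r (Suc k)) * B $$ (i, j))"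
    by (simp add: resolvent_index sum_distrib_right)
  also have "\<dots> = (\<Sum>i<n. \<Sum>k<n. \<Sum>j<n. Q $$ (j, k) * Q $$ (i, k) / (x - r (Suc k)) * B $$ (i, j))"
    by (intro sum.cong refl sum.swap)
  also have "\<dots> = (\<Sum>k<n. \<Sum>i<n. \<Sum>j<n. Q $$ (j, k) * Q $$ (i, k) / (x - r (Suc k)) * B $$ (i, j))"
    by (rule sum.swap)
  also have "\<dots> = (\<Sum>k<n. (col Q k \<bullet> (B *\<^sub>v col Q k)) / (x - r (Suc k)))"
  proof (rule sum.cong[OF refl])
    fix k assume "k \<in> {..<n}"
    then show "(\<Sum>i<n. \<Sum>j<n. Q $$ (j, k) * Q $$ (i, k) / (x - r (Suc k)) * B $$ (i, j))
        = (col Q k \<bullet> (B *\<^sub>v col Q k)) / (x - r (Suc k))"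
      using B Q_carrier
      by (simp add: scalar_prod_def atLeast0LessThan sum_divide_distrib sum_distrib_left mult_ac)
  qed
  also have "cmod \<dots> \<le> (\<Sum>k<n. 1 / cmod (x - r (Suc k)) * mat_norm2 B)"
  proof (rule sum_norm_le)
    fix k assume "k \<in> {..<n}"
    then have k: "k < n" by simp
    let ?q = "col Q k"
    have q: "?q \<in> carrier_vec n" by (intro carrier_vecI) simp
    have q1: "vec_norm2 ?q = 1"
      using norm_Phi_pos[of "r (Suc k)"] by (simp add: Q_col[OF k] vec_norm2_smult norm_divide)
    have "cmod (?q \<bullet> (B *\<^sub>v ?q)) \<le> vec_norm2 ?q * vec_norm2 (B *\<^sub>v ?q)"
      using B q by (intro cmod_scalar_prod_le) auto
    also have "\<dots> \<le> mat_norm2 B"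
      using mat_norm2_bound[OF B q] by (simp add: q1)
    finally show "cmod ((?q \<bullet> (B *\<^sub>v ?q)) / (x - r (Suc k))) \<le> 1 / cmod (x - r (Suc k)) * mat_norm2 B"
      by (simp add: norm_divide divide_right_mono)
  qed
  also have "\<dots> = root_sum n r x * mat_norm2 B"
  proof -
    have "(\<Sum>k<n. 1 / cmod (x - r (Suc k))) = root_sum n r x"
      unfolding root_sum_def by (rule sum.reindex_bij_witness[of _ "\<lambda>j. j - 1" Suc]) auto
    then show ?thesis by (simp only: sum_distrib_right[symmetric])
  qed
  finally show ?thesis .
qed

end

end

subsection \<open>Perturbation at a point\<close>

lemma scalar_prod_mult_vec_sum:
  fixes B :: "complex mat"
  assumes "B \<in> carrier_mat n n" "w \<in> carrier_vec n" "z \<in> carrier_vec n"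
  shows "z \<bullet> (B *\<^sub>v w) = (\<Sum>i<n. \<Sum>j<n. z $ i * w $ j * B $$ (i, j))"
  using assms by (auto simp: scalar_prod_def atLeast0LessThan sum_distrib_left algebra_simps intro!: sum.cong)

lemma norm_diff_mono:
  fixes a b :: "'a::real_normed_vector"
  assumes "norm a \<le> r" "norm b \<le> s"
  shows "norm (a - b) \<le> r + s"
  using norm_triangle_mono[of a r "- b" s] assms by simp

context symmetric_basis
begin

definition node_bound :: "complex Matrix.vec \<Rightarrow> complex \<Rightarrow> real \<Rightarrow> real \<Rightarrow> real \<Rightarrow> real" where
  "node_bound c x \<epsilon>H \<epsilon>1 \<epsilon>c = Gamma_1 n \<phi> r c x * \<epsilon>1 + Gamma_c n \<phi> x * \<epsilon>c + Gamma_H n \<phi> r c x * \<epsilon>H"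

context
  fixes x :: complex and c :: "complex Matrix.vec"
  assumes nonroot: "f x \<noteq> 0" and c: "c \<in> carrier_vec n"
begin

text \<open>\<open>B\<close> is the exact change of xI - C, including the product of the
  perturbations of e_1 and c. Hence the extra \<epsilon>1 * \<epsilon>c term, which is later
  absorbed into the remainder.\<close>

lemma first_order_bound:
  assumes dH: "\<delta>H \<in> carrier_mat n n" "mat_norm2 \<delta>H \<le> \<epsilon>H"
    and d1: "\<delta>e1 \<in> carrier_vec n" "vec_norm2 \<delta>e1 \<le> \<epsilon>1"
    and dc: "\<delta>c \<in> carrier_vec n" "vec_norm2 \<delta>c \<le> \<epsilon>c"
  defines "B \<equiv> outer_prod (unit_vec n 0) \<delta>c + outer_prod \<delta>e1 c + outer_prod \<delta>e1 \<delta>c - \<delta>H"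
  shows "cmod (\<nu> * det_deriv (shifted x + outer_prod (unit_vec n 0) c) B)
    \<le> node_bound c x \<epsilon>H \<epsilon>1 \<epsilon>c
      + (cmod (f x) + 2 * Gamma_c n \<phi> x * vec_norm2 c) * root_max n r x * (\<epsilon>1 * \<epsilon>c)"
proof -
  let ?e = "unit_vec n 0 :: complex Matrix.vec"
  define W where "W = resolvent x"
  define w where "w = W *\<^sub>v ?e"
  define z where "z = W *\<^sub>v c"
  define y where "y = W *\<^sub>v \<delta>e1"
  define M where "M = root_max n r x"
  define S where "S = root_sum n r x"
  define T where "T = (\<lambda>X. \<Sum>i<n. \<Sum>j<n. W $$ (j, i) * X $$ (i, j))"
  have W: "W \<in> carrier_mat n n" by (simp add: W_def)
  have carr: "w \<in> carrier_vec n" "z \<in> carrier_vec n" "y \<in> carrier_vec n"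
    using W c d1 by (auto simp: w_def z_def y_def)
  have B: "B \<in> carrier_mat n n"
    using c dH d1 dc unfolding B_def by (intro minus_carrier_mat) auto
  have WT: "transpose_mat W = W" unfolding W_def by (rule resolvent_symmetric[OF nonroot])
  have swap: "(W *\<^sub>v u) \<bullet> v = u \<bullet> (W *\<^sub>v v)" if "u \<in> carrier_vec n" "v \<in> carrier_vec n" for u v
    using transpose_vec_mult_scalar[OF W that(2,1)] by (simp add: WT)
  have B_index: "B $$ (i, j) = ?e $ i * \<delta>c $ j + \<delta>e1 $ i * c $ j + \<delta>e1 $ i * \<delta>c $ j - \<delta>H $$ (i, j)"
    if "i < n" "j < n" for i j
    using that c dH d1 dc by (simp add: B_def)
  \<comment> \<open>The trace of W u v^T is v^T W u; the next fact is the analogue for the other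
    term of the derivative.\<close>
  have T_outer: "(\<Sum>i<n. \<Sum>j<n. W $$ (j, i) * (u $ i * v $ j)) = v \<bullet> (W *\<^sub>v u)"
    if "u \<in> carrier_vec n" "v \<in> carrier_vec n" for u v
    using that W by (subst sum.swap) (simp add: scalar_prod_def atLeast0LessThan sum_distrib_left mult_ac)
  have Z_outer: "(\<Sum>i<n. \<Sum>j<n. z $ i * w $ j * (u $ i * v $ j)) = (z \<bullet> u) * (v \<bullet> w)"
    if "u \<in> carrier_vec n" "v \<in> carrier_vec n" for u v
    using that carr by (simp add: scalar_prod_def atLeast0LessThan sum_product mult_ac)
  have TB: "T B = \<delta>c \<bullet> w + c \<bullet> y + \<delta>c \<bullet> y - T \<delta>H"
  proof -
    have "T B = (\<Sum>i<n. \<Sum>j<n. W $$ (j, i) * (?e $ i * \<delta>c $ j))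
        + (\<Sum>i<n. \<Sum>j<n. W $$ (j, i) * (\<delta>e1 $ i * c $ j))
        + (\<Sum>i<n. \<Sum>j<n. W $$ (j, i) * (\<delta>e1 $ i * \<delta>c $ j)) - T \<delta>H"
      unfolding T_def by (simp add: B_index distrib_left right_diff_distrib sum.distrib sum_subtractf
          del: index_unit_vec(1,2))
    then show ?thesis
      using c d1 dc by (simp add: T_outer w_def y_def del: index_unit_vec(1,2))
  qed
  have ZB: "z \<bullet> (B *\<^sub>v w) = (c \<bullet> w) * (\<delta>c \<bullet> w) + (c \<bullet> y) * (c \<bullet> w) + (c \<bullet> y) * (\<delta>c \<bullet> w) - z \<bullet> (\<delta>H *\<^sub>v w)"
  proof -
    have "z \<bullet> (B *\<^sub>v w) = (\<Sum>i<n. \<Sum>j<n. z $ i * w $ j * (?e $ i * \<delta>c $ j))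
        + (\<Sum>i<n. \<Sum>j<n. z $ i * w $ j * (\<delta>e1 $ i * c $ j))
        + (\<Sum>i<n. \<Sum>j<n. z $ i * w $ j * (\<delta>e1 $ i * \<delta>c $ j)) - z \<bullet> (\<delta>H *\<^sub>v w)"
      unfolding scalar_prod_mult_vec_sum[OF B carr(1,2)] scalar_prod_mult_vec_sum[OF dH(1) carr(1,2)]
      by (simp add: B_index distrib_left right_diff_distrib sum.distrib sum_subtractf del: index_unit_vec(1,2))
    moreover have "z \<bullet> ?e = c \<bullet> w" "z \<bullet> \<delta>e1 = c \<bullet> y"
      unfolding z_def w_def y_def using c d1 by (auto intro!: swap)
    ultimately show ?thesis
      using c d1 dc by (simp add: Z_outer del: index_unit_vec(1,2))
  qed
  \<comment> \<open>In (1 + c . w) T(B) - z . (B w) the terms linear in \<delta>c or \<delta>e1 have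
    lost the factor 1 + c . w; it is left only on the mixed term and on \<delta>H.\<close>
  define G where "G = \<delta>c \<bullet> w + c \<bullet> y + (1 + c \<bullet> w) * (\<delta>c \<bullet> y) - (c \<bullet> y) * (\<delta>c \<bullet> w)
      - (1 + c \<bullet> w) * T \<delta>H + z \<bullet> (\<delta>H *\<^sub>v w)"
  have deriv: "\<nu> * det_deriv (shifted x + outer_prod ?e c) B = f x * G"
  proof -
    have "det_deriv (shifted x + outer_prod ?e c) B
        = det (shifted x) * ((1 + c \<bullet> w) * T B - z \<bullet> (B *\<^sub>v w))"
      using det_deriv_rank_one[OF _ shifted_carrier W _ c B, of x] shifted_resolvent[OF nonroot] n
      unfolding T_def w_def z_def by (simp add: W_def resolvent_symmetric[OF nonroot])
    also have "(1 + c \<bullet> w) * T B - z \<bullet> (B *\<^sub>v w) = G"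
      unfolding TB ZB G_def by (simp add: algebra_simps)
    finally show ?thesis
      by (simp add: det_shifted mult.assoc[symmetric])
  qed
  define k where "k = vec_norm2 c"
  define \<omega> where "\<omega> = vec_norm2 w"
  have nonneg: "0 \<le> k" "0 \<le> \<omega>" "0 \<le> \<epsilon>1" "0 \<le> \<epsilon>c"
    using order.trans[OF vec_norm2_nonneg d1(2)] order.trans[OF vec_norm2_nonneg dc(2)]
    by (auto simp: k_def \<omega>_def)
  \<comment> \<open>Multiplying by |phi_n(x)| removes the denominator of W e_1, so the identity is
    exact and each \<omega> below becomes a Gamma_c.\<close>
  have \<omega>: "cmod (f x) * \<omega> = Gamma_c n \<phi> x"
    unfolding \<omega>_def w_def W_def resolvent_unit[OF nonroot]
    using nonroot chi_pos by (simp add: vec_norm2_smult norm_divide Gamma_c_def)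
  have M: "0 \<le> M"
  proof -
    have "0 \<le> 1 / cmod (x - r 1)" by simp
    also have "\<dots> \<le> M" unfolding M_def root_max_def using n by (intro Max_ge) auto
    finally show ?thesis .
  qed
  have S: "0 \<le> S" by (simp add: S_def root_sum_def sum_nonneg)
  have z_le: "vec_norm2 z \<le> M * k"
    unfolding z_def M_def k_def W_def by (rule resolvent_norm[OF nonroot c])
  have y_le: "vec_norm2 y \<le> M * \<epsilon>1"
    using resolvent_norm[OF nonroot d1(1)] mult_left_mono[OF d1(2) M]
    unfolding y_def M_def W_def by linarith
  have dot: "cmod (u \<bullet> v) \<le> a * b"
    if "dim_vec u = dim_vec v" "vec_norm2 u \<le> a" "vec_norm2 v \<le> b"
    for u v :: "complex Matrix.vec" and a b :: real
    using cmod_scalar_prod_le[OF that(1)] mult_mono[OF that(2,3)] that(2) vec_norm2_nonneg[of u]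
      vec_norm2_nonneg[of v] by linarith
  have b1: "cmod (\<delta>c \<bullet> w) \<le> \<epsilon>c * \<omega>"
    by (rule dot) (use dc carr in \<open>auto simp: \<omega>_def\<close>)
  have b2: "cmod (c \<bullet> y) \<le> k * (M * \<epsilon>1)"
    by (rule dot) (use c carr y_le in \<open>auto simp: k_def\<close>)
  have b3: "cmod (\<delta>c \<bullet> y) \<le> \<epsilon>c * (M * \<epsilon>1)"
    by (rule dot) (use dc carr y_le in auto)
  have "cmod (c \<bullet> w) \<le> k * \<omega>"
    by (rule dot) (use c carr in \<open>auto simp: k_def \<omega>_def\<close>)
  then have b4: "cmod (1 + c \<bullet> w) \<le> 1 + k * \<omega>"
    using norm_triangle_ineq[of 1 "c \<bullet> w"] by simp
  have eH: "0 \<le> \<epsilon>H"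
  proof -
    have "0 \<le> mat_norm2 \<delta>H"
      using order.trans[OF norm_ge_zero cmod_index_le_mat_norm2[OF dH(1), of 0 0]] n by simp
    then show ?thesis using dH(2) by linarith
  qed
  have b5: "cmod (T \<delta>H) \<le> S * \<epsilon>H"
    using resolvent_trace[OF nonroot dH(1)] mult_left_mono[OF dH(2) S]
    unfolding T_def S_def W_def by linarith
  have b6: "cmod (z \<bullet> (\<delta>H *\<^sub>v w)) \<le> M * k * (\<epsilon>H * \<omega>)"
  proof (rule dot)
    show "vec_norm2 (\<delta>H *\<^sub>v w) \<le> \<epsilon>H * \<omega>"
      using mat_norm2_bound[OF dH(1) carr(1)] mult_right_mono[OF dH(2) nonneg(2)]
      unfolding \<omega>_def by linarith
  qed (use dH carr z_le in auto)
  have "cmod G \<le> cmod (\<delta>c \<bullet> w) + cmod (c \<bullet> y) + cmod (1 + c \<bullet> w) * cmod (\<delta>c \<bullet> y)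
      + cmod (c \<bullet> y) * cmod (\<delta>c \<bullet> w) + cmod (1 + c \<bullet> w) * cmod (T \<delta>H) + cmod (z \<bullet> (\<delta>H *\<^sub>v w))"
    unfolding G_def norm_mult[symmetric]
    by (intro norm_triangle_mono norm_diff_mono order.refl)
  also have "\<dots> \<le> \<epsilon>c * \<omega> + k * (M * \<epsilon>1) + (1 + k * \<omega>) * (\<epsilon>c * (M * \<epsilon>1))
      + k * (M * \<epsilon>1) * (\<epsilon>c * \<omega>) + (1 + k * \<omega>) * (S * \<epsilon>H) + M * k * (\<epsilon>H * \<omega>)"
    using nonneg M S eH by (intro add_mono mult_mono b1 b2 b3 b4 b5 b6) auto
  finally have "cmod (f x) * cmod G \<le> cmod (f x) * (\<epsilon>c * \<omega> + k * (M * \<epsilon>1) + (1 + k * \<omega>) * (\<epsilon>c * (M * \<epsilon>1))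
      + k * (M * \<epsilon>1) * (\<epsilon>c * \<omega>) + (1 + k * \<omega>) * (S * \<epsilon>H) + M * k * (\<epsilon>H * \<omega>))"
    by (intro mult_left_mono) auto
  also have "\<dots> = node_bound c x \<epsilon>H \<epsilon>1 \<epsilon>c
      + (cmod (f x) + 2 * Gamma_c n \<phi> x * vec_norm2 c) * root_max n r x * (\<epsilon>1 * \<epsilon>c)"
    unfolding node_bound_def Gamma_1_def Gamma_H_def \<omega>[symmetric] M_def S_def k_def
    by (simp add: algebra_simps)
  finally show ?thesis
    by (simp add: deriv norm_mult)
qed

text \<open>\<open>K\<close> depends on the three bounds but not on the perturbations, which
  provides the uniformity behind the O-term. Continuity at the origin will make it locally
  bounded.\<close>

lemma perturbation_at_node:
  "\<exists>K. isCont K (0, 0, 0) \<and> (\<forall>\<epsilon>H \<epsilon>1 \<epsilon>c \<delta>H \<delta>e1 \<delta>c.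
      \<delta>H \<in> carrier_mat n n \<longrightarrow> mat_norm2 \<delta>H \<le> \<epsilon>H \<longrightarrow>
      \<delta>e1 \<in> carrier_vec n \<longrightarrow> vec_norm2 \<delta>e1 \<le> \<epsilon>1 \<longrightarrow>
      \<delta>c \<in> carrier_vec n \<longrightarrow> vec_norm2 \<delta>c \<le> \<epsilon>c \<longrightarrow>
      cmod (\<nu> * poly (char_poly (cmat H + \<delta>H - outer_prod (unit_vec n 0 + \<delta>e1) (c + \<delta>c))) x
          - \<nu> * poly (char_poly (cmat H - outer_prod (unit_vec n 0) c)) x)
        \<le> node_bound c x \<epsilon>H \<epsilon>1 \<epsilon>c + K (\<epsilon>H, \<epsilon>1, \<epsilon>c) * (\<epsilon>H\<^sup>2 + \<epsilon>1\<^sup>2 + \<epsilon>c\<^sup>2))"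
proof -
  let ?e = "unit_vec n 0 :: complex Matrix.vec"
  define A where "A = shifted x + outer_prod ?e c"
  have A: "A \<in> carrier_mat n n" using c by (simp add: A_def)
  define k where "k = vec_norm2 c"
  \<comment> \<open>The sum dominates every entry of \<open>A\<close>; the added 1 secures the
    condition 1 \<le> \<alpha> of \<open>det_add_second_order_le\<close>.\<close>
  define \<alpha> where "\<alpha> = 1 + (\<Sum>i<n. \<Sum>j<n. cmod (A $$ (i, j)))"
  \<comment> \<open>An entrywise bound for the perturbation, one summand for each of its four
    parts.\<close>
  define \<beta> where "\<beta> = (\<lambda>(\<epsilon>H, \<epsilon>1, \<epsilon>c). \<epsilon>H + \<epsilon>c + \<epsilon>1 * k + \<epsilon>1 * \<epsilon>c :: real)"
  define K2 where "K2 = (cmod (f x) + 2 * Gamma_c n \<phi> x * k) * root_max n r x"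
  \<comment> \<open>\<open>K2\<close> is the coefficient of \<epsilon>1 * \<epsilon>c from
    \<open>first_order_bound\<close>. The rest is the determinant remainder, with the squared entry
    bound replaced by 3 (1 + k + \<epsilon>c)^2 times the sum of squares.\<close>
  define K where "K = (\<lambda>(\<epsilon>H, \<epsilon>1, \<epsilon>c). K2
      + lead_coeff (\<phi> n) * (fact n * ((real n)\<^sup>2 * (3 * (1 + k + \<epsilon>c)\<^sup>2) * (\<alpha> + \<beta> (\<epsilon>H, \<epsilon>1, \<epsilon>c)) ^ n)))"
  have "isCont K (0, 0, 0)"
    unfolding K_def \<beta>_def case_prod_beta by (intro continuous_intros)
  moreover have "cmod (\<nu> * poly (char_poly (cmat H + \<delta>H - outer_prod (?e + \<delta>e1) (c + \<delta>c))) x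
          - \<nu> * poly (char_poly (cmat H - outer_prod ?e c)) x)
        \<le> node_bound c x \<epsilon>H \<epsilon>1 \<epsilon>c + K (\<epsilon>H, \<epsilon>1, \<epsilon>c) * (\<epsilon>H\<^sup>2 + \<epsilon>1\<^sup>2 + \<epsilon>c\<^sup>2)"
    if dH: "\<delta>H \<in> carrier_mat n n" "mat_norm2 \<delta>H \<le> \<epsilon>H"
      and d1: "\<delta>e1 \<in> carrier_vec n" "vec_norm2 \<delta>e1 \<le> \<epsilon>1"
      and dc: "\<delta>c \<in> carrier_vec n" "vec_norm2 \<delta>c \<le> \<epsilon>c"
    for \<epsilon>H \<epsilon>1 \<epsilon>c \<delta>H \<delta>e1 \<delta>c
  proof -
    define B where "B = outer_prod ?e \<delta>c + outer_prod \<delta>e1 c + outer_prod \<delta>e1 \<delta>c - \<delta>H"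
    define b where "b = \<beta> (\<epsilon>H, \<epsilon>1, \<epsilon>c)"
    define s where "s = \<epsilon>H\<^sup>2 + \<epsilon>1\<^sup>2 + \<epsilon>c\<^sup>2"
    have B: "B \<in> carrier_mat n n"
      using c dH d1 dc unfolding B_def by (intro minus_carrier_mat) auto
    have "0 \<le> mat_norm2 \<delta>H"
      using order.trans[OF norm_ge_zero cmod_index_le_mat_norm2[OF dH(1), of 0 0]] n by simp
    then have nonneg: "0 \<le> \<epsilon>H" "0 \<le> \<epsilon>1" "0 \<le> \<epsilon>c" "0 \<le> k"
      using dH(2) order.trans[OF vec_norm2_nonneg d1(2)] order.trans[OF vec_norm2_nonneg dc(2)]
      by (auto simp: k_def)
    have b0: "0 \<le> b" using nonneg by (simp add: b_def \<beta>_def)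
    have perturbed: "x \<cdot>\<^sub>m 1\<^sub>m n - (cmat H + \<delta>H - outer_prod (?e + \<delta>e1) (c + \<delta>c)) = A + B"
      using c dH d1 dc unfolding A_def B_def
      by (intro eq_matI) (auto simp: algebra_simps simp del: index_unit_vec(1,2))
    have unperturbed: "x \<cdot>\<^sub>m 1\<^sub>m n - (cmat H - outer_prod ?e c) = A"
      using c unfolding A_def by (intro eq_matI) (auto simp del: index_unit_vec(1,2))
    have "cmod (det (A + B) - det A - det_deriv A B) \<le> fact n * ((real n)\<^sup>2 * b\<^sup>2 * (\<alpha> + b) ^ n)"
    proof (rule det_add_second_order_le[OF A B])
      fix i j assume ij: "i < n" "j < n"
      have "cmod (A $$ (i, j)) \<le> (\<Sum>j<n. cmod (A $$ (i, j)))"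
        using ij by (intro member_le_sum) auto
      also have "\<dots> \<le> (\<Sum>i<n. \<Sum>j<n. cmod (A $$ (i, j)))"
        using ij by (intro member_le_sum[of i _ "\<lambda>i. \<Sum>j<n. cmod (A $$ (i, j))"]) (auto intro: sum_nonneg)
      finally show "cmod (A $$ (i, j)) \<le> \<alpha>" by (simp add: \<alpha>_def)
      have ent: "cmod (v $ l) \<le> a" if "v \<in> carrier_vec n" "vec_norm2 v \<le> a" "l < n" for v a l
        using cmod_index_le_vec_norm2[of l v] that by simp
      have "cmod (B $$ (i, j)) = cmod (?e $ i * \<delta>c $ j + \<delta>e1 $ i * c $ j + \<delta>e1 $ i * \<delta>c $ j - \<delta>H $$ (i, j))"
        using ij c dH d1 dc by (simp add: B_def)
      also have "\<dots> \<le> cmod (?e $ i) * cmod (\<delta>c $ j) + cmod (\<delta>e1 $ i) * cmod (c $ j)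
          + cmod (\<delta>e1 $ i) * cmod (\<delta>c $ j) + cmod (\<delta>H $$ (i, j))"
        unfolding norm_mult[symmetric]
        by (intro norm_diff_mono norm_triangle_mono order.refl)
      also have "\<dots> \<le> 1 * \<epsilon>c + \<epsilon>1 * k + \<epsilon>1 * \<epsilon>c + \<epsilon>H"
        using nonneg n ij c d1 dc order.trans[OF cmod_index_le_mat_norm2[OF dH(1) ij] dH(2)]
        by (intro add_mono mult_mono ent) (auto simp: k_def)
      finally show "cmod (B $$ (i, j)) \<le> b" by (simp add: b_def \<beta>_def)
    qed (use b0 in \<open>auto simp: \<alpha>_def intro!: sum_nonneg\<close>)
    also have "\<dots> \<le> fact n * ((real n)\<^sup>2 * ((3 * (1 + k + \<epsilon>c)\<^sup>2) * s) * (\<alpha> + b) ^ n)"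
    proof -
      have "b \<le> (1 + k + \<epsilon>c) * (\<epsilon>H + \<epsilon>1 + \<epsilon>c)"
        using nonneg by (simp add: b_def \<beta>_def algebra_simps)
      then have "b\<^sup>2 \<le> ((1 + k + \<epsilon>c) * (\<epsilon>H + \<epsilon>1 + \<epsilon>c))\<^sup>2"
        using b0 by (intro power_mono)
      also have "\<dots> \<le> (1 + k + \<epsilon>c)\<^sup>2 * (3 * s)"
      proof -
        \<comment> \<open>Origin of the constant 3: the square of a sum of three numbers is at most
          three times the sum of their squares.\<close>
        have "0 \<le> (\<epsilon>H - \<epsilon>1)\<^sup>2 + (\<epsilon>H - \<epsilon>c)\<^sup>2 + (\<epsilon>1 - \<epsilon>c)\<^sup>2" by simp
        then have "(\<epsilon>H + \<epsilon>1 + \<epsilon>c)\<^sup>2 \<le> 3 * s"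
          unfolding s_def by (simp add: power2_eq_square algebra_simps)
        then show ?thesis unfolding power_mult_distrib by (intro mult_left_mono) auto
      qed
      finally have "b\<^sup>2 \<le> 3 * (1 + k + \<epsilon>c)\<^sup>2 * s" by (simp add: mult_ac)
      moreover have "0 \<le> \<alpha>" by (auto simp: \<alpha>_def intro!: add_nonneg_nonneg sum_nonneg)
      ultimately show ?thesis
        using b0 by (intro mult_left_mono mult_right_mono) auto
    qed
    finally have rem: "cmod (det (A + B) - det A - det_deriv A B)
        \<le> fact n * ((real n)\<^sup>2 * ((3 * (1 + k + \<epsilon>c)\<^sup>2) * s) * (\<alpha> + b) ^ n)" .
    have lead: "0 < lead_coeff (\<phi> n)" using lead_basis[of n] by simp
    have "\<nu> * det (A + B) - \<nu> * det A = \<nu> * det_deriv A B + \<nu> * (det (A + B) - det A - det_deriv A B)"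
      by (simp add: algebra_simps)
    also have "cmod \<dots> \<le> cmod (\<nu> * det_deriv A B) + lead_coeff (\<phi> n) * cmod (det (A + B) - det A - det_deriv A B)"
      using lead by (intro order.trans[OF norm_triangle_ineq]) (simp add: norm_mult)
    also have "\<dots> \<le> (node_bound c x \<epsilon>H \<epsilon>1 \<epsilon>c + K2 * s)
        + lead_coeff (\<phi> n) * (fact n * ((real n)\<^sup>2 * ((3 * (1 + k + \<epsilon>c)\<^sup>2) * s) * (\<alpha> + b) ^ n))"
    proof (intro add_mono mult_left_mono rem)
      have "K2 * (\<epsilon>1 * \<epsilon>c) \<le> K2 * s"
      proof (rule mult_left_mono)
        have "0 \<le> (\<epsilon>1 - \<epsilon>c)\<^sup>2 + 2 * \<epsilon>H\<^sup>2 + \<epsilon>1\<^sup>2 + \<epsilon>c\<^sup>2" by simp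
        then show "\<epsilon>1 * \<epsilon>c \<le> s" by (simp add: s_def power2_eq_square algebra_simps)
        have "0 \<le> 1 / cmod (x - r 1)" by simp
        also have "\<dots> \<le> root_max n r x" unfolding root_max_def using n by (intro Max_ge) auto
        finally show "0 \<le> K2"
          using nonneg chi_pos by (simp add: K2_def Gamma_c_def)
      qed
      then show "cmod (\<nu> * det_deriv A B) \<le> node_bound c x \<epsilon>H \<epsilon>1 \<epsilon>c + K2 * s"
        using first_order_bound[OF dH d1 dc] unfolding A_def B_def K2_def k_def by linarith
    qed (use lead in auto)
    also have "\<dots> = node_bound c x \<epsilon>H \<epsilon>1 \<epsilon>c + K (\<epsilon>H, \<epsilon>1, \<epsilon>c) * s"
      by (simp add: K_def b_def algebra_simps)
    finally show ?thesis
      using c dH d1 dc H_carrier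
      by (subst (1 2) poly_char_poly[of _ n]) (auto simp: perturbed unperturbed s_def intro!: minus_carrier_mat)
  qed
  ultimately show ?thesis by blast
qed

end

end

subsection \<open>Passage to the coefficients\<close>

context symmetric_basis
begin

text \<open>Interpolation at n + 1 points reproduces q, and \<open>L\<close> converts the nodal
  values into coefficients for phi_0 to phi_n. Only phi_n has a term of degree n, so deg q < n
  forces \<open>d n = 0\<close>. This is why the first n rows of \<open>L\<close> suffice.\<close>

lemma difference_in_basis:
  assumes l: "lagrange_polys n \<rho> l" and L: "coeff_matrix n \<phi> l L"
    and inj: "inj_on \<rho> {0..n}" and deg: "degree q < n"
  defines "d \<equiv> \<lambda>i. \<Sum>j\<le>n. poly q (complex_of_real (\<rho> j)) * complex_of_real (L $$ (i, j))"
  shows "q = (\<Sum>i<n. Polynomial.smult (d i) (cpoly (\<phi> i)))"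
proof -
  let ?q = "\<lambda>j. poly q (complex_of_real (\<rho> j))"
  have interp: "q = (\<Sum>j\<le>n. Polynomial.smult (?q j) (cpoly (l j)))" (is "q = ?I")
  proof (rule poly_eqI_degree[of "(\<lambda>j. complex_of_real (\<rho> j)) ` {0..n}"])
    fix y assume "y \<in> (\<lambda>j. complex_of_real (\<rho> j)) ` {0..n}"
    then obtain i where i: "i \<le> n" "y = complex_of_real (\<rho> i)" by auto
    have "poly (cpoly (l j)) y = (if i = j then 1 else 0)" if "j \<le> n" for j
      using l i that by (simp add: lagrange_polys_def)
    then have "poly ?I y = (\<Sum>j\<le>n. ?q j * (if i = j then 1 else 0))"
      by (simp add: poly_sum)
    also have "\<dots> = poly q y"
      using i by (simp add: if_distrib cong: if_cong)
    finally show "poly q y = poly ?I y" ..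
  next
    have card: "card ((\<lambda>j. complex_of_real (\<rho> j)) ` {0..n}) = n + 1"
      using inj by (subst card_image) (auto simp: inj_on_def)
    show "degree q < card ((\<lambda>j. complex_of_real (\<rho> j)) ` {0..n})"
      using deg card by simp
    have "degree (Polynomial.smult (?q j) (cpoly (l j))) \<le> n" if "j \<in> {..n}" for j
      using that l degree_smult_le[of "?q j" "cpoly (l j)"] degree_map_poly_le[of complex_of_real "l j"]
      by (auto simp: lagrange_polys_def intro: order.trans)
    then have "degree ?I \<le> n" by (intro degree_sum_le) auto
    then show "degree ?I < card ((\<lambda>j. complex_of_real (\<rho> j)) ` {0..n})"
      using card by simp
  qed
  have "cpoly (l j) = (\<Sum>i\<le>n. Polynomial.smult (complex_of_real (L $$ (i, j))) (cpoly (\<phi> i)))" if "j \<le> n" for j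
  proof (rule poly_eqI)
    fix k
    have "l j = (\<Sum>i\<le>n. Polynomial.smult (L $$ (i, j)) (\<phi> i))"
      using L that by (simp add: coeff_matrix_def)
    then have "coeff (l j) k = (\<Sum>i\<le>n. L $$ (i, j) * coeff (\<phi> i) k)"
      by (simp add: coeff_sum)
    then show "coeff (cpoly (l j)) k
        = coeff (\<Sum>i\<le>n. Polynomial.smult (complex_of_real (L $$ (i, j))) (cpoly (\<phi> i))) k"
      by (simp add: coeff_map_poly coeff_sum)
  qed
  then have "q = (\<Sum>j\<le>n. \<Sum>i\<le>n. Polynomial.smult (?q j * complex_of_real (L $$ (i, j))) (cpoly (\<phi> i)))"
    using interp by (simp add: smult_sum2)
  also have "\<dots> = (\<Sum>i\<le>n. Polynomial.smult (d i) (cpoly (\<phi> i)))"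
    unfolding d_def smult_sum by (rule sum.swap)
  also have "\<dots> = (\<Sum>i<n. Polynomial.smult (d i) (cpoly (\<phi> i))) + Polynomial.smult (d n) (cpoly (\<phi> n))"
    by (simp add: lessThan_Suc_atMost[symmetric])
  finally have expand: "q = (\<Sum>i<n. Polynomial.smult (d i) (cpoly (\<phi> i))) + Polynomial.smult (d n) (cpoly (\<phi> n))" .
  have "coeff (cpoly (\<phi> i)) n = 0" if "i < n" for i
    using degree_basis[of i] that by (simp add: coeff_map_poly coeff_eq_0)
  then have "coeff q n = d n * \<nu>"
    using degree_basis[of n] by (subst expand) (simp add: coeff_sum coeff_map_poly)
  moreover have "coeff q n = 0" using deg by (rule coeff_eq_0)
  ultimately have "d n = 0" using nu_nonzero by simp
  then show ?thesis using expand by simp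
qed

lemma coefficient_bound:
  assumes L: "L \<in> carrier_mat (n + 1) (n + 1)" and i: "i < n"
    and q: "\<And>j. j \<le> n \<Longrightarrow> cmod (q j) \<le> m"
  shows "cmod (\<Sum>j\<le>n. q j * complex_of_real (L $$ (i, j))) \<le> mat_norm_inf (first_rows n L) * m"
proof -
  have m: "0 \<le> m" using order.trans[OF norm_ge_zero q[of 0]] by simp
  have "cmod (\<Sum>j\<le>n. q j * complex_of_real (L $$ (i, j))) \<le> (\<Sum>j\<le>n. \<bar>L $$ (i, j)\<bar> * m)"
    by (rule sum_norm_le) (auto simp: norm_mult mult.commute intro!: mult_right_mono q)
  also have "\<dots> = (\<Sum>j\<le>n. \<bar>L $$ (i, j)\<bar>) * m"
    by (simp add: sum_distrib_right)
  also have "(\<Sum>j\<le>n. \<bar>L $$ (i, j)\<bar>) = (\<Sum>j<dim_col (first_rows n L). \<bar>first_rows n L $$ (i, j)\<bar>)"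
    using L i by (simp add: first_rows_def lessThan_Suc_atMost[symmetric])
  also have "\<dots> * m \<le> mat_norm_inf (first_rows n L) * m"
    unfolding mat_norm_inf_def using i m
    by (intro mult_right_mono Max_ge) (auto simp: first_rows_def)
  finally show ?thesis .
qed

lemma uniform_perturbation:
  assumes c: "c \<in> carrier_vec n" and nonroot: "\<And>j. j \<le> n \<Longrightarrow> f (x j) \<noteq> 0"
  shows "\<exists>K. isCont K (0, 0, 0) \<and> (\<forall>j\<le>n. \<forall>\<epsilon>H \<epsilon>1 \<epsilon>c \<delta>H \<delta>e1 \<delta>c.
      \<delta>H \<in> carrier_mat n n \<longrightarrow> mat_norm2 \<delta>H \<le> \<epsilon>H \<longrightarrow>
      \<delta>e1 \<in> carrier_vec n \<longrightarrow> vec_norm2 \<delta>e1 \<le> \<epsilon>1 \<longrightarrow>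
      \<delta>c \<in> carrier_vec n \<longrightarrow> vec_norm2 \<delta>c \<le> \<epsilon>c \<longrightarrow>
      cmod (\<nu> * poly (char_poly (cmat H + \<delta>H - outer_prod (unit_vec n 0 + \<delta>e1) (c + \<delta>c))) (x j)
          - \<nu> * poly (char_poly (cmat H - outer_prod (unit_vec n 0) c)) (x j))
        \<le> node_bound c (x j) \<epsilon>H \<epsilon>1 \<epsilon>c + K (\<epsilon>H, \<epsilon>1, \<epsilon>c) * (\<epsilon>H\<^sup>2 + \<epsilon>1\<^sup>2 + \<epsilon>c\<^sup>2))"
    (is "\<exists>K. ?cont K \<and> (\<forall>j\<le>n. ?P j K)")
proof -
  have "\<forall>j. \<exists>K. j \<le> n \<longrightarrow> ?cont K \<and> ?P j K"
    using perturbation_at_node[OF nonroot c] by blast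
  then obtain K where K: "\<And>j. j \<le> n \<Longrightarrow> ?cont (K j)" "\<And>j. j \<le> n \<Longrightarrow> ?P j (K j)"
    by metis
  \<comment> \<open>Summing absolute values gives one function that dominates the bounds of all
    nodes and is still continuous at the origin.\<close>
  have "?cont (\<lambda>\<epsilon>. \<Sum>j\<le>n. \<bar>K j \<epsilon>\<bar>)"
    by (intro continuous_sum continuous_rabs K) simp
  moreover have "?P j (\<lambda>\<epsilon>. \<Sum>j\<le>n. \<bar>K j \<epsilon>\<bar>)" if j: "j \<le> n" for j
  proof -
    have "K j \<epsilon> * s \<le> (\<Sum>j\<le>n. \<bar>K j \<epsilon>\<bar>) * s" if "0 \<le> s" for \<epsilon> s
    proof (rule mult_right_mono[OF _ that])
      have "\<bar>K j \<epsilon>\<bar> \<le> (\<Sum>j\<le>n. \<bar>K j \<epsilon>\<bar>)" using j by (intro member_le_sum) auto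
      then show "K j \<epsilon> \<le> (\<Sum>j\<le>n. \<bar>K j \<epsilon>\<bar>)" by linarith
    qed
    then show ?thesis
      by (intro allI impI order.trans[OF K(2)[OF j, rule_format] add_left_mono]) auto
  qed
  ultimately show ?thesis by blast
qed

end

theorem theorem5p1:
  fixes n :: nat and \<mu> :: "real measure" and \<phi> :: "nat \<Rightarrow> real poly"
    and H :: "real mat" and c :: "complex Matrix.vec" and C :: "complex mat"
    and p :: "complex poly" and r :: "nat \<Rightarrow> complex"
    and \<rho> :: "nat \<Rightarrow> real" and l :: "nat \<Rightarrow> real poly" and L :: "real mat"
  assumes "n \<ge> 1"
    and "orthogonal_polys \<mu> n \<phi>"
    and "\<forall>j\<le>n. lead_coeff (\<phi> j) > 0"
    and "associated_matrix n \<phi> H"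
    and "transpose_mat H = H"
    and "c \<in> carrier_vec n"
    and "C = cmat H - outer_prod (unit_vec n 0) c"
    and "p = Polynomial.smult (complex_of_real (lead_coeff (\<phi> n))) (char_poly C)"
    and "proots (cpoly (\<phi> n)) = image_mset r (mset_set {1..n})"
    and "inj_on \<rho> {0..n}"
    and "\<forall>j\<le>n. \<rho> j \<in> {-1..1} \<and> poly (\<phi> n) (\<rho> j) \<noteq> 0"
    and "lagrange_polys n \<rho> l"
    and "coeff_matrix n \<phi> l L"
  shows "\<exists>R :: real \<times> real \<times> real \<Rightarrow> real.
    R \<in> O[nhds (0, 0, 0)](\<lambda>(\<epsilon>H, \<epsilon>1, \<epsilon>c). \<epsilon>H\<^sup>2 + \<epsilon>1\<^sup>2 + \<epsilon>c\<^sup>2) \<and>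
    (\<forall>\<epsilon>H \<epsilon>1 \<epsilon>c \<delta>H \<delta>e1 \<delta>c \<delta>C \<delta>p.
       \<delta>H \<in> carrier_mat n n \<and> mat_norm2 \<delta>H \<le> \<epsilon>H \<and> \<epsilon>H < 1 \<and>
       \<delta>e1 \<in> carrier_vec n \<and> vec_norm2 \<delta>e1 \<le> \<epsilon>1 \<and>
       \<delta>c \<in> carrier_vec n \<and> vec_norm2 \<delta>c \<le> \<epsilon>c \<and>
       \<delta>C \<in> carrier_mat n n \<and>
       C + \<delta>C = cmat H + \<delta>H - outer_prod (unit_vec n 0 + \<delta>e1) (c + \<delta>c) \<and>
       p + \<delta>p = Polynomial.smult (complex_of_real (lead_coeff (\<phi> n))) (char_poly (C + \<delta>C))
       \<longrightarrow> (\<exists>d :: nat \<Rightarrow> complex.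
              \<delta>p = (\<Sum>j<n. Polynomial.smult (d j) (cpoly (\<phi> j))) \<and>
              (MAX j\<in>{..<n}. cmod (d j))
                \<le> mat_norm_inf (first_rows n L) *
                    (MAX j\<in>{0..n}. Gamma_1 n \<phi> r c (complex_of_real (\<rho> j)) * \<epsilon>1
                                  + Gamma_c n \<phi> (complex_of_real (\<rho> j)) * \<epsilon>c
                                  + Gamma_H n \<phi> r c (complex_of_real (\<rho> j)) * \<epsilon>H)
                  + R (\<epsilon>H, \<epsilon>1, \<epsilon>c)))"
proof -
  interpret symmetric_basis n \<phi> H r
    using assms(1-5,9) by unfold_locales (auto simp: orthogonal_polys_def)
  let ?x = "\<lambda>j. complex_of_real (\<rho> j)"
  have c: "c \<in> carrier_vec n" by fact
  have nonroot: "f (?x j) \<noteq> 0" if "j \<le> n" for j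
    using assms(11) that by simp
  obtain K where K_cont: "isCont K (0, 0, 0)" and K: "\<And>j \<epsilon>H \<epsilon>1 \<epsilon>c \<delta>H \<delta>e1 \<delta>c. j \<le> n \<Longrightarrow>
      \<delta>H \<in> carrier_mat n n \<Longrightarrow> mat_norm2 \<delta>H \<le> \<epsilon>H \<Longrightarrow>
      \<delta>e1 \<in> carrier_vec n \<Longrightarrow> vec_norm2 \<delta>e1 \<le> \<epsilon>1 \<Longrightarrow>
      \<delta>c \<in> carrier_vec n \<Longrightarrow> vec_norm2 \<delta>c \<le> \<epsilon>c \<Longrightarrow>
      cmod (\<nu> * poly (char_poly (cmat H + \<delta>H - outer_prod (unit_vec n 0 + \<delta>e1) (c + \<delta>c))) (?x j)
          - \<nu> * poly (char_poly (cmat H - outer_prod (unit_vec n 0) c)) (?x j))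
        \<le> node_bound c (?x j) \<epsilon>H \<epsilon>1 \<epsilon>c + K (\<epsilon>H, \<epsilon>1, \<epsilon>c) * (\<epsilon>H\<^sup>2 + \<epsilon>1\<^sup>2 + \<epsilon>c\<^sup>2)"
    using uniform_perturbation[of c ?x, OF c nonroot] by blast
  define N where "N = mat_norm_inf (first_rows n L)"
  define s :: "real \<times> real \<times> real \<Rightarrow> real" where "s = (\<lambda>(\<epsilon>H, \<epsilon>1, \<epsilon>c). \<epsilon>H\<^sup>2 + \<epsilon>1\<^sup>2 + \<epsilon>c\<^sup>2)"
  \<comment> \<open>The remainder at the nodes, amplified by the norm of the truncated matrix when
    values are turned into coefficients.\<close>
  define R where "R = (\<lambda>\<epsilon>. N * K \<epsilon> * s \<epsilon>)"
  have "R \<in> O[nhds (0, 0, 0)](s)"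
  proof -
    \<comment> \<open>Continuity of \<open>K\<close> makes N K convergent, hence bounded, near the
      origin. The filter \<open>nhds\<close> includes the origin itself, so convergence must hold
      there and not only along the punctured filter.\<close>
    have "((\<lambda>\<epsilon>. N * K \<epsilon>) \<longlongrightarrow> N * K (0, 0, 0)) (nhds (0, 0, 0))"
      using K_cont by (intro tendsto_mult tendsto_const) (simp add: isCont_def tendsto_at_iff_tendsto_nhds)
    then have "(\<lambda>\<epsilon>. N * K \<epsilon>) \<in> O[nhds (0, 0, 0)](\<lambda>_. 1)"
      by (intro bigoI_tendsto[where c = "N * K (0, 0, 0)"]) auto
    from landau_o.big.mult[OF this landau_o.big_refl[of s]] show ?thesis
      by (simp add: R_def)
  qed
  moreover have "\<exists>d :: nat \<Rightarrow> complex.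
      \<delta>p = (\<Sum>j<n. Polynomial.smult (d j) (cpoly (\<phi> j))) \<and>
      (MAX j\<in>{..<n}. cmod (d j)) \<le> N * (MAX j\<in>{0..n}. node_bound c (?x j) \<epsilon>H \<epsilon>1 \<epsilon>c) + R (\<epsilon>H, \<epsilon>1, \<epsilon>c)"
    if dH: "\<delta>H \<in> carrier_mat n n" "mat_norm2 \<delta>H \<le> \<epsilon>H"
      and d1: "\<delta>e1 \<in> carrier_vec n" "vec_norm2 \<delta>e1 \<le> \<epsilon>1"
      and dc: "\<delta>c \<in> carrier_vec n" "vec_norm2 \<delta>c \<le> \<epsilon>c"
      and dC: "C + \<delta>C = cmat H + \<delta>H - outer_prod (unit_vec n 0 + \<delta>e1) (c + \<delta>c)"
      and dp: "p + \<delta>p = Polynomial.smult \<nu> (char_poly (C + \<delta>C))"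
    for \<epsilon>H \<epsilon>1 \<epsilon>c \<delta>H \<delta>e1 \<delta>c \<delta>C \<delta>p
  proof -
    let ?M = "MAX j\<in>{0..n}. node_bound c (?x j) \<epsilon>H \<epsilon>1 \<epsilon>c"
    let ?C' = "cmat H + \<delta>H - outer_prod (unit_vec n 0 + \<delta>e1) (c + \<delta>c)"
    have C: "C \<in> carrier_mat n n" and C': "?C' \<in> carrier_mat n n"
      using assms(6,7) c d1 dc by (auto intro!: minus_carrier_mat)
    have \<delta>p: "\<delta>p = Polynomial.smult \<nu> (char_poly ?C' - char_poly C)"
      using dp assms(8) unfolding dC by (simp add: smult_diff_right algebra_simps)
    \<comment> \<open>Both characteristic polynomials are monic of degree n, so their leading terms
      cancel.\<close>
    have "degree (char_poly ?C' - char_poly C) < n"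
    proof (rule degree_lessI)
      show "\<forall>k\<ge>n. coeff (char_poly ?C' - char_poly C) k = 0"
        using degree_monic_char_poly[OF C] degree_monic_char_poly[OF C']
        by (metis coeff_diff coeff_eq_0 diff_self le_neq_implies_less)
    qed (use n in simp)
    then have deg: "degree \<delta>p < n"
      unfolding \<delta>p by (rule le_less_trans[OF degree_smult_le])
    define d where "d = (\<lambda>i. \<Sum>j\<le>n. poly \<delta>p (?x j) * complex_of_real (L $$ (i, j)))"
    have "\<delta>p = (\<Sum>j<n. Polynomial.smult (d j) (cpoly (\<phi> j)))"
      unfolding d_def by (rule difference_in_basis[OF assms(12,13,10) deg])
    moreover have "(MAX j\<in>{..<n}. cmod (d j)) \<le> N * (?M + K (\<epsilon>H, \<epsilon>1, \<epsilon>c) * s (\<epsilon>H, \<epsilon>1, \<epsilon>c))"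
    proof (rule Max.boundedI)
      fix y assume "y \<in> (\<lambda>j. cmod (d j)) ` {..<n}"
      then obtain i where i: "i < n" "y = cmod (d i)" by auto
      show "y \<le> N * (?M + K (\<epsilon>H, \<epsilon>1, \<epsilon>c) * s (\<epsilon>H, \<epsilon>1, \<epsilon>c))"
        unfolding i(2) d_def N_def
      proof (rule coefficient_bound[OF _ i(1)])
        show "L \<in> carrier_mat (n + 1) (n + 1)" using assms(13) by (simp add: coeff_matrix_def)
        fix j assume j: "j \<le> n"
        have "cmod (poly \<delta>p (?x j)) \<le> node_bound c (?x j) \<epsilon>H \<epsilon>1 \<epsilon>c + K (\<epsilon>H, \<epsilon>1, \<epsilon>c) * s (\<epsilon>H, \<epsilon>1, \<epsilon>c)"
          using K[OF j dH d1 dc] unfolding \<delta>p assms(7) by (simp add: s_def right_diff_distrib)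
        also have "node_bound c (?x j) \<epsilon>H \<epsilon>1 \<epsilon>c \<le> ?M"
          using j by (intro Max_ge) auto
        finally show "cmod (poly \<delta>p (?x j)) \<le> ?M + K (\<epsilon>H, \<epsilon>1, \<epsilon>c) * s (\<epsilon>H, \<epsilon>1, \<epsilon>c)"
          by simp
      qed
    qed (use n in \<open>auto simp: lessThan_empty_iff\<close>)
    ultimately show ?thesis
      by (intro exI[of _ d]) (simp add: R_def algebra_simps)
  qed
  ultimately show ?thesis
    unfolding s_def node_bound_def N_def by blast
qed

end
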